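(* Let $d\ge 1$ be an integer, let $\boldsymbol{M}=(M_1,\dots,M_d)$ be such that $\mathcal{F}(\boldsymbol{M})$ is nonempty, let $\mu\in[0,1)$, and put $M_0=1$ and $l=\lceil (d+1)/2\rceil$. Then there is exactly one distribution $\underline F\in\mathcal{F}$ of the form $\underline F=\sum_{i=1}^{l} f_i\,\delta(x_i)$, with $0\le x_1<\dots<x_l\le1$ and $f_1,\dots,f_l\ge0$, satisfying - if $d$ is odd: $\sum_{i=1}^{l} f_i x_i^m=M_m$ for $m=0,1,\dots,d$; - if $d$ is even: $\sum_{i=1}^{l} f_i x_i^m=M_m$ for $m=0,1,\dots,d$, with $x_1=0$; and the supremum in $$\sup_{F\in\mathcal{F}(\boldsymbol{M})}\big(D_{\min}(F,\mu)-D_{\min}^{(d)}(\boldsymbol{M},\mu)\big)=\sup_{F\in\mathcal{F}(\boldsymbol{M})}D_{\min}(F,\mu)-D_{\min}^{(d)}(\boldsymbol{M},\mu)$$ is attained by $F=\underline F$.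
   Context: $\mathcal{F}$ is the family of all (Borel) probability distributions on $[0,1]$, and $\mathrm{E}_F[\cdot]$ denotes expectation when $X$ has distribution $F$. The Kullback-Leibler divergence is $D(F\Vert G)=\mathrm{E}_F[\log \frac{\mathrm{d}F}{\mathrm{d}G}]$ if the density $\frac{\mathrm{d}F}{\mathrm{d}G}$ exists, and $D(F\Vert G)=+\infty$ otherwise. For $F\in\mathcal{F}$ and $\mu\in[0,1]$, $$D_{\min}(F,\mu)=\min_{G\in\mathcal{F}:\,\mathrm{E}_G[X]\ge\mu} D(F\Vert G).$$ For $\boldsymbol{M}=(M_1,\dots,M_d)$ let $\mathcal{F}(\boldsymbol{M})=\{F\in\mathcal{F}:(\mathrm{E}_F[X],\dots,\mathrm{E}_F[X^d])=\boldsymbol{M}\}$ and $D_{\min}^{(d)}(\boldsymbol{M},\mu)=\inf_{F\in\mathcal{F}(\boldsymbol{M})}D_{\min}(F,\mu)$. $\delta(x)$ is the unit point mass at $x$. The convention $0^0=1$ is used. Weights $f_i$ are allowed to be zero, and uniqueness refers to the distribution $\underline F$. *)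

theory Defs
  imports "HOL-Probability.Probability"
begin

(* A distribution on [0,1] is a Borel probability measure on the real line
   carried by {0..1}; two distributions are equal iff equal as measures. *)
definition dists01 :: "real measure set" where
  "dists01 = {F. prob_space F \<and> sets F = sets borel \<and> emeasure F {0..1} = 1}"

(* Expectation with values in the extended reals.  Needed because the Bochner
   integral (and hence KL_divergence) is 0, not infinite, when a function is not
   integrable. *)
definition ext_expectation :: "real measure \<Rightarrow> (real \<Rightarrow> real) \<Rightarrow> ereal" where
  "ext_expectation F h =
     enn2ereal (\<integral>\<^sup>+ x. ennreal (h x) \<partial>F) - enn2ereal (\<integral>\<^sup>+ x. ennreal (- h x) \<partial>F)"

(* kl_div F G is D(F||G), natural logarithm.  Argument order is opposite to
   RN_deriv and KL_divergence: RN_deriv G F is dF/dG. *)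
definition kl_div :: "real measure \<Rightarrow> real measure \<Rightarrow> ereal" where
  "kl_div F G =
     (if \<exists>g\<in>borel_measurable G. density G g = F
      then ext_expectation F (\<lambda>x. ln (enn2real (RN_deriv G F x)))
      else \<infinity>)"

lemma kl_div_eq_KL_divergence:
  assumes "\<exists>g\<in>borel_measurable G. density G g = F"
    and "integrable F (entropy_density (exp 1) G F)"
  shows "kl_div F G = ereal (KL_divergence (exp 1) G F)"
proof -
  let ?h = "\<lambda>x. ln (enn2real (RN_deriv G F x))"
  have h: "entropy_density (exp 1) G F = ?h"
    by (auto simp: entropy_density_def log_def)
  have i: "integrable F ?h"
    using assms(2) h by simp
  have fin: "(\<integral>\<^sup>+ x. ennreal (?h x) \<partial>F) \<noteq> \<infinity>" "(\<integral>\<^sup>+ x. ennreal (- ?h x) \<partial>F) \<noteq> \<infinity>"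
    using integrableD(2,3)[OF i] by simp_all
  have "ext_expectation F ?h = ereal (integral\<^sup>L F ?h)"
    unfolding ext_expectation_def real_lebesgue_integral_def[OF i] using fin
    by (cases "\<integral>\<^sup>+ x. ennreal (?h x) \<partial>F"; cases "\<integral>\<^sup>+ x. ennreal (- ?h x) \<partial>F")
      (simp_all add: enn2ereal_ennreal)
  then show ?thesis
    using assms(1) by (simp add: kl_div_def KL_divergence_def h)
qed

definition D_min :: "real measure \<Rightarrow> real \<Rightarrow> ereal" where
  "D_min F \<mu> = (INF G\<in>{G \<in> dists01. integral\<^sup>L G (\<lambda>x. x) \<ge> \<mu>}. kl_div F G)"

definition moment_class :: "nat \<Rightarrow> (nat \<Rightarrow> real) \<Rightarrow> real measure set" where
  "moment_class d M = {F \<in> dists01. \<forall>m\<in>{1..d}. integral\<^sup>L F (\<lambda>x. x ^ m) = M m}"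

definition D_min_moments :: "nat \<Rightarrow> (nat \<Rightarrow> real) \<Rightarrow> real \<Rightarrow> ereal" where
  "D_min_moments d M \<mu> = (INF F\<in>moment_class d M. D_min F \<mu>)"

(* F = sum_{i=1..l} f_i delta(x_i), as an equality of measures on Borel sets;
   return borel z is the unit point mass at z. *)
definition is_point_mass_sum ::
    "real measure \<Rightarrow> nat \<Rightarrow> (nat \<Rightarrow> real) \<Rightarrow> (nat \<Rightarrow> real) \<Rightarrow> bool" where
  "is_point_mass_sum F l f x \<longleftrightarrow>
     sets F = sets borel \<and>
     (\<forall>A\<in>sets borel. emeasure F A =
        (\<Sum>i=1..l. ennreal (f i) * emeasure (return borel (x i)) A))"

definition is_lower_rep :: "nat \<Rightarrow> (nat \<Rightarrow> real) \<Rightarrow> real measure \<Rightarrow> bool" where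
  "is_lower_rep d M F \<longleftrightarrow>
     F \<in> dists01 \<and>
     (let l = nat \<lceil>(real d + 1) / 2\<rceil> in
      \<exists>f x. is_point_mass_sum F l f x \<and>
        0 \<le> x 1 \<and> strict_mono_on {1..l} x \<and> x l \<le> 1 \<and>
        (\<forall>i\<in>{1..l}. 0 \<le> f i) \<and>
        (odd d \<longrightarrow> (\<forall>m\<in>{0..d}. (\<Sum>i=1..l. f i * x i ^ m) = M m)) \<and>
        (even d \<longrightarrow> (\<forall>m\<in>{0..d}. (\<Sum>i=1..l. f i * x i ^ m) = M m) \<and> x 1 = 0))"

end

theory Submission
  imports Defs
begin

text \<open>
  Write \<open>L\<^sub>F(\<nu>) = E\<^sub>F[ln (1 - (X - \<mu>) \<nu>)]\<close>. By the Gibbs inequality and an explicit optimal tilting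
  of \<open>F\<close>, \<open>D_min F \<mu>\<close> is the supremum of \<open>L\<^sub>F(\<nu>)\<close> over \<open>0 \<le> \<nu> < 1 / (1 - \<mu>)\<close>, so it suffices to
  compare \<open>L\<^sub>F\<close> for a single \<open>\<nu>\<close>. Since \<open>L\<^sub>F(0) = 0\<close> and the derivative of \<open>L\<^sub>F\<close> is an affine function
  of \<open>E\<^sub>F[1 / (A - X)]\<close> with \<open>A = \<mu> + 1 / \<nu> > 1\<close> and a negative slope, this reduces to the Markov inequality
  that the Gauss (odd \<open>d\<close>) or Gauss--Radau (even \<open>d\<close>) quadrature formula of the moments minimises
  \<open>E\<^sub>F[1 / (A - X)]\<close>.

  The quadrature formula comes from the roots of an orthogonal polynomial. On the boundary of the moment
  space that polynomial is replaced by the one of least degree that has norm zero. Uniqueness holds because two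
  such formulas together have at most \<open>d + 1\<close> nodes, and on these every function is interpolated by a
  polynomial of degree at most \<open>d\<close>.
\<close>

section \<open>Quadrature for positive functionals on polynomials\<close>

text \<open>Bounding coefficients instead of \<open>degree\<close> makes
  \<open>polys_below 0\<close> equal to \<open>{0}\<close> and the closure properties immediate;
  \<open>degree 0 = 0\<close> would make zero an exception throughout.\<close>

definition polys_below :: "nat \<Rightarrow> real poly set" where
  "polys_below m = {p. \<forall>i\<ge>m. coeff p i = 0}"

lemma polys_below_0 [simp]: "0 \<in> polys_below m"
  by (simp add: polys_below_def)

lemma polys_below_add: "p \<in> polys_below m \<Longrightarrow> q \<in> polys_below m \<Longrightarrow> p + q \<in> polys_below m"
  by (simp add: polys_below_def)

lemma polys_below_diff: "p \<in> polys_below m \<Longrightarrow> q \<in> polys_below m \<Longrightarrow> p - q \<in> polys_below m"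
  by (simp add: polys_below_def)

lemma polys_below_smult: "p \<in> polys_below m \<Longrightarrow> smult c p \<in> polys_below m"
  by (simp add: polys_below_def)

lemma polys_below_mono: "p \<in> polys_below m \<Longrightarrow> m \<le> n \<Longrightarrow> p \<in> polys_below n"
  by (simp add: polys_below_def)

lemma degree_less_imp_polys_below: "degree p < m \<Longrightarrow> p \<in> polys_below m"
  by (simp add: polys_below_def coeff_eq_0)

lemma polys_below_iff: "p \<in> polys_below m \<longleftrightarrow> p = 0 \<or> degree p < m"
proof
  assume p: "p \<in> polys_below m"
  show "p = 0 \<or> degree p < m"
  proof (rule ccontr)
    assume "\<not> (p = 0 \<or> degree p < m)"
    then have "coeff p (degree p) = 0" "p \<noteq> 0" using p by (auto simp: polys_below_def)
    then show False by simp
  qed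
qed (auto intro: degree_less_imp_polys_below)

definition root_poly :: "real set \<Rightarrow> real poly" where
  "root_poly S = (\<Prod>z\<in>S. [:- z, 1:])"

lemma degree_root_poly: "degree (root_poly S) = card S"
  by (cases "finite S") (simp_all add: root_poly_def degree_prod_eq_sum_degree)

lemma root_poly_neq_0 [simp]: "root_poly S \<noteq> 0"
  by (cases "finite S") (simp_all add: root_poly_def)

lemma degree_linear_mult:
  fixes s :: "real poly"
  assumes "s \<noteq> 0"
  shows "degree ([:- z, 1:] * s) = Suc (degree s)"
  using assms by (subst degree_mult_eq) simp_all

lemma poly_root_poly_eq_0_iff: "finite S \<Longrightarrow> poly (root_poly S) x = 0 \<longleftrightarrow> x \<in> S"
  by (auto simp: root_poly_def poly_prod)

lemma poly_eq_0_if_roots: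
  fixes p :: "real poly"
  assumes "p \<in> polys_below (card S)" "finite S" "\<And>x. x \<in> S \<Longrightarrow> poly p x = 0"
  shows "p = 0"
proof (rule ccontr)
  assume "p \<noteq> 0"
  then have "card S \<le> card {x. poly p x = 0}" using assms(3)
    by (intro card_mono poly_roots_finite) auto
  also have "\<dots> \<le> degree p" using \<open>p \<noteq> 0\<close> by (rule card_poly_roots_bound)
  finally show False using assms(1) \<open>p \<noteq> 0\<close> by (auto simp: polys_below_iff)
qed

lemma root_poly_dvd:
  assumes "finite S" "\<And>x. x \<in> S \<Longrightarrow> poly p x = 0"
  shows "root_poly S dvd p"
  using assms
proof (induction S rule: finite_induct)
  case empty
  then show ?case by (simp add: root_poly_def)
next
  case (insert a S)
  then obtain u where u: "p = root_poly S * u" by (auto elim: dvdE)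
  have "poly u a = 0" using insert.prems[of a] insert.hyps
    by (auto simp: u poly_root_poly_eq_0_iff)
  then obtain v where "u = [:- a, 1:] * v" by (auto simp: poly_eq_0_iff_dvd elim: dvdE)
  moreover have "root_poly (insert a S) = [:- a, 1:] * root_poly S" using insert.hyps
    by (simp add: root_poly_def)
  ultimately have "p = root_poly (insert a S) * v" by (simp only: u ac_simps)
  then show ?case by simp
qed

text \<open>Newton's form: a multiple of \<open>root_poly S\<close> corrects the value at the new
  point without disturbing the values on \<open>S\<close>.\<close>

lemma polynomial_interpolation:
  fixes g :: "real \<Rightarrow> real"
  assumes "finite S"
  shows "\<exists>p\<in>polys_below (card S). \<forall>x\<in>S. poly p x = g x"
  using assms
proof (induction S rule: finite_induct)
  case empty
  show ?case by (rule bexI[of _ 0]) simp_all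
next
  case (insert a S)
  then obtain p where p: "p \<in> polys_below (card S)" "\<forall>x\<in>S. poly p x = g x" by auto
  define c where "c = (g a - poly p a) / poly (root_poly S) a"
  have nz: "poly (root_poly S) a \<noteq> 0" using insert.hyps by (simp add: poly_root_poly_eq_0_iff)
  have "p + smult c (root_poly S) \<in> polys_below (card (insert a S))"
    using insert.hyps
    by (intro polys_below_add polys_below_smult polys_below_mono[OF p(1)])
      (auto intro!: degree_less_imp_polys_below simp: degree_root_poly)
  moreover have "poly (p + smult c (root_poly S)) x = g x" if "x \<in> insert a S" for x
    using that p(2) nz insert.hyps
    by (auto simp: c_def poly_root_poly_eq_0_iff[THEN iffD2])
  ultimately show ?case by blast
qed

section \<open>Positive functionals and their orthogonal polynomials\<close>

text \<open>Kept abstract because Gauss quadrature is applied to two functionals: the expectation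
  under a distribution and, for the Radau formula, a given functional precomposed with
  multiplication by \<open>X\<close>.\<close>

locale positive_functional =
  fixes \<Lambda> :: "real poly \<Rightarrow> real"
  assumes add: "\<Lambda> (p + q) = \<Lambda> p + \<Lambda> q"
    and smult: "\<Lambda> (smult c p) = c * \<Lambda> p"
    and nonneg: "(\<And>x. 0 \<le> x \<Longrightarrow> x \<le> 1 \<Longrightarrow> 0 \<le> poly p x) \<Longrightarrow> 0 \<le> \<Lambda> p"
begin

lemma diff: "\<Lambda> (p - q) = \<Lambda> p - \<Lambda> q"
  using add[of "p - q" q] by simp

lemma zero [simp]: "\<Lambda> 0 = 0"
  using smult[of 0 0] by simp

lemma square_nonneg: "0 \<le> \<Lambda> (p * p)"
  by (rule nonneg) simp

lemma sum: "\<Lambda> (\<Sum>i\<in>I. p i) = (\<Sum>i\<in>I. \<Lambda> (p i))"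
  by (induction I rule: infinite_finite_induct) (simp_all add: add)

text \<open>The degenerate case of Cauchy-Schwarz: \<open>\<Lambda>\<close> is nonnegative at the
  square of \<open>p + smult t s\<close> for every \<open>t\<close>, and without the
  \<open>p * p\<close> term the linear term in \<open>t\<close> must vanish.\<close>

lemma null_square_orthogonal:
  assumes "\<Lambda> (p * p) = 0"
  shows "\<Lambda> (p * s) = 0"
proof -
  define a where "a = \<Lambda> (p * s)"
  define b where "b = \<Lambda> (s * s)"
  have *: "0 \<le> 2 * t * a + t * t * b" for t
  proof -
    have "(p + smult t s) * (p + smult t s) = p * p + smult t (p * s) + smult t (p * s) + smult (t * t) (s * s)"
      by (simp add: algebra_simps)
    from arg_cong[OF this, of \<Lambda>] show ?thesis
      using square_nonneg[of "p + smult t s"] by (simp only: add smult a_def b_def assms)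
  qed
  have b: "b \<ge> 0" unfolding b_def by (rule square_nonneg)
  \<comment> \<open>The choice \<open>t = - (a * c)\<close> nearly minimises the quadratic; dividing
    by \<open>b + 1\<close> instead of \<open>b\<close> covers \<open>b = 0\<close>.\<close>
  define c where "c = 1 / (b + 1)"
  have c: "0 < c" "c * b \<le> 1" using b by (simp_all add: c_def)
  have "a\<^sup>2 * (c * (2 - c * b)) \<le> 0" using *[of "- (a * c)"] by (simp add: algebra_simps power2_eq_square)
  then have "a = 0" using c by (auto simp: mult_le_0_iff)
  then show ?thesis by (simp add: a_def)
qed

definition pos_def_below :: "nat \<Rightarrow> bool" where
  "pos_def_below m \<longleftrightarrow> (\<forall>s\<in>polys_below m. s \<noteq> 0 \<longrightarrow> 0 < \<Lambda> (s * s))"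

text \<open>Gram-Schmidt by induction on \<open>m\<close>. The induction hypothesis is used for
  \<open>monom 1 m\<close>, which produces a monic \<open>e\<close> orthogonal to all lower degrees,
  and for \<open>p\<close>, whose projection then gains a component along \<open>e\<close>.\<close>

lemma orthogonal_projection:
  assumes "pos_def_below m"
  shows "\<exists>t\<in>polys_below m. \<forall>s\<in>polys_below m. \<Lambda> ((p - t) * s) = 0"
  using assms
proof (induction m arbitrary: p)
  case 0
  then show ?case by (auto intro!: bexI[of _ 0] simp: polys_below_iff)
next
  case (Suc m)
  have pd: "pos_def_below m" using Suc.prems
    using polys_below_mono[of _ m "Suc m"] by (auto simp: pos_def_below_def)
  obtain u where u: "u \<in> polys_below m" "\<And>s. s \<in> polys_below m \<Longrightarrow> \<Lambda> ((monom 1 m - u) * s) = 0"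
    using Suc.IH[OF pd] by blast
  obtain t where t: "t \<in> polys_below m" "\<And>s. s \<in> polys_below m \<Longrightarrow> \<Lambda> ((p - t) * s) = 0"
    using Suc.IH[OF pd] by blast
  define e where "e = monom 1 m - u"
  have em: "coeff e m = 1" using u(1) by (simp add: e_def polys_below_def)
  then have e0: "e \<noteq> 0" by auto
  have eb: "e \<in> polys_below (Suc m)" unfolding e_def
    by (intro polys_below_diff polys_below_mono[OF u(1)]) (auto simp: polys_below_def)
  have epos: "0 < \<Lambda> (e * e)" using Suc.prems eb e0 by (auto simp: pos_def_below_def)
  define c where "c = \<Lambda> ((p - t) * e) / \<Lambda> (e * e)"
  have "\<Lambda> ((p - (t + smult c e)) * s) = 0" if s: "s \<in> polys_below (Suc m)" for s
  proof -
    \<comment> \<open>As \<open>e\<close> is monic of degree \<open>m\<close>, subtracting this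
      multiple brings \<open>s\<close> into \<open>polys_below m\<close>, where both orthogonality
      relations apply.\<close>
    define s' where "s' = s - smult (coeff s m) e"
    have s': "s' \<in> polys_below m"
      unfolding polys_below_def
    proof (intro CollectI allI impI)
      fix i assume "m \<le> i"
      then show "coeff s' i = 0" using s eb em
        by (cases "i = m") (auto simp: s'_def polys_below_def)
    qed
    have "s = smult (coeff s m) e + s'" by (simp add: s'_def)
    then have "(p - (t + smult c e)) * s = smult (coeff s m) ((p - t) * e) - smult (coeff s m * c) (e * e)
        + ((p - t) * s' - smult c (e * s'))"
      by (metis (no_types, lifting) ring_distribs(1) left_diff_distrib diff_diff_eq mult_smult_left mult_smult_right smult_diff_right smult_smult)
    then show ?thesis using t(2)[OF s'] u(2)[OF s'] epos
      by (simp add: add diff smult c_def flip: e_def)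
  qed
  moreover have "t + smult c e \<in> polys_below (Suc m)"
    by (intro polys_below_add polys_below_smult eb polys_below_mono[OF t(1)]) simp
  ultimately show ?case by blast
qed

text \<open>If \<open>\<Lambda>\<close> is positive definite below \<open>n\<close>,
  \<open>q\<close> is the usual orthogonal polynomial, with \<open>k = n\<close>. Otherwise
  definiteness first fails at \<open>k + 1\<close>, and \<open>q\<close> is a null vector of degree
  \<open>k\<close>, orthogonal to every polynomial. The range \<open>2 * n - k\<close> is what the
  quotient needs when a polynomial of degree below \<open>2 * n\<close> is divided by
  \<open>q\<close>.\<close>

lemma ex_orthogonal_polynomial:
  "\<exists>k q. k \<le> n \<and> q \<noteq> 0 \<and> degree q = k \<and> pos_def_below k \<and>
     (\<forall>s\<in>polys_below (2 * n - k). \<Lambda> (q * s) = 0)"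
proof (cases "pos_def_below n")
  case True
  then obtain u where u: "u \<in> polys_below n" "\<And>s. s \<in> polys_below n \<Longrightarrow> \<Lambda> ((monom 1 n - u) * s) = 0"
    using orthogonal_projection by blast
  have c: "coeff (monom 1 n - u) n = 1" using u(1) by (simp add: polys_below_def)
  have "degree (monom 1 n - u) \<le> n"
    using u(1) by (intro degree_le) (auto simp: polys_below_def)
  with c have "degree (monom 1 n - u) = n" by (simp add: le_antisym le_degree)
  moreover have "monom 1 n - u \<noteq> 0" using c by (metis coeff_0 zero_neq_one)
  ultimately show ?thesis using True u(2) by (intro exI[of _ n] exI[of _ "monom 1 n - u"]) simp
next
  case False
  define m where "m = (LEAST m. \<not> pos_def_below m)"
  have m: "\<not> pos_def_below m" "m \<le> n" unfolding m_def
    using False by (rule LeastI[of "\<lambda>m. \<not> pos_def_below m"], rule Least_le)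
  have "pos_def_below 0" by (auto simp: pos_def_below_def polys_below_iff)
  with m obtain k where k: "m = Suc k" by (cases m) auto
  have pd: "pos_def_below k" using not_less_Least[of k "\<lambda>m. \<not> pos_def_below m"] k
    by (auto simp: m_def)
  obtain q where q: "q \<in> polys_below (Suc k)" "q \<noteq> 0" "\<not> 0 < \<Lambda> (q * q)"
    using m(1) k by (auto simp: pos_def_below_def)
  have "\<Lambda> (q * q) = 0" using q(3) square_nonneg[of q] by simp
  moreover have "degree q = k"
    using q pd by (auto simp: pos_def_below_def polys_below_iff less_Suc_eq)
  ultimately show ?thesis using q(2) pd null_square_orthogonal m(2) k
    by (intro exI[of _ k] exI[of _ q]) auto
qed

text \<open>Once the distinct zeros in the unit interval are split off, the cofactor
  \<open>u\<close> must be constant: a zero of \<open>u\<close> in the interval would be a multiple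
  zero of \<open>q\<close>, and if \<open>u\<close> had positive degree and no such zero,
  \<open>q * root_poly T\<close> would have constant sign although \<open>\<Lambda>\<close>
  annihilates it.\<close>

lemma orthogonal_polynomial_roots:
  assumes "q \<noteq> 0" "pos_def_below (degree q)" "\<And>s. s \<in> polys_below (degree q) \<Longrightarrow> \<Lambda> (q * s) = 0"
  shows "card {x\<in>{0..1}. poly q x = 0} = degree q"
proof -
  define T where "T = {x\<in>{0..1}. poly q x = 0}"
  have fin: "finite T" unfolding T_def using poly_roots_finite[OF assms(1)] by (rule rev_finite_subset) auto
  obtain u where u: "q = root_poly T * u"
    using root_poly_dvd[OF fin, of q] by (auto simp: T_def elim: dvdE)
  have u0: "u \<noteq> 0" using assms(1) u by auto
  have deg: "degree q = card T + degree u"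
    using u0 by (simp add: u degree_mult_eq degree_root_poly)
  have no_root: "poly u z \<noteq> 0" if z: "z \<in> {0..1}" for z
  proof
    assume uz: "poly u z = 0"
    then obtain v where v: "u = [:- z, 1:] * v" by (auto simp: poly_eq_0_iff_dvd elim: dvdE)
    have "poly q z = 0" using uz by (simp add: u)
    then have "z \<in> T" using z by (simp add: T_def)
    then have "root_poly T = [:- z, 1:] * root_poly (T - {z})"
      using fin by (simp add: root_poly_def prod.remove)
    \<comment> \<open>\<open>z\<close> is a multiple root, so \<open>q * s\<close> is a square for \<open>s = q / (X - z)\<^sup>2\<close>.\<close>
    then have q: "q = [:- z, 1:] * ([:- z, 1:] * (root_poly (T - {z}) * v))"
      by (simp only: u v ac_simps)
    define s where "s = root_poly (T - {z}) * v"
    have s0: "s \<noteq> 0" using q assms(1) unfolding s_def by fastforce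
    have ls0: "[:- z, 1:] * s \<noteq> 0" using s0 by (simp only: mult_eq_0_iff) simp
    have "degree q = Suc (Suc (degree s))"
      unfolding q s_def[symmetric] by (simp only: degree_linear_mult[OF ls0] degree_linear_mult[OF s0])
    moreover have "degree ([:- z, 1:] * s) = Suc (degree s)" using s0 by (rule degree_linear_mult)
    ultimately have "s \<in> polys_below (degree q)" "[:- z, 1:] * s \<in> polys_below (degree q)"
      by (auto intro!: degree_less_imp_polys_below)
    moreover have "q * s = ([:- z, 1:] * s) * ([:- z, 1:] * s)"
      by (simp only: q s_def ac_simps)
    ultimately show False using assms(2,3) ls0 unfolding pos_def_below_def by (metis less_irrefl)
  qed
  have "degree u = 0"
  proof (rule ccontr)
    assume "degree u \<noteq> 0"
    then have R: "root_poly T \<in> polys_below (degree q)"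
      by (intro degree_less_imp_polys_below) (simp add: deg degree_root_poly)
    define Q where "Q = root_poly T * root_poly T"
    have Q: "0 < \<Lambda> Q" using R assms(2) by (auto simp: pos_def_below_def Q_def)
    have Qu: "\<Lambda> (u * Q) = 0" using assms(3)[OF R] by (simp add: u Q_def ac_simps)
    have Qx: "0 \<le> poly Q x" for x by (simp add: Q_def)
    \<comment> \<open>\<open>\<Lambda>\<close> is only known to preserve weak positivity, so the
      contradiction needs a uniform positive lower bound \<open>\<epsilon>\<close> for the absolute
      value of \<open>u\<close>, taken from compactness.\<close>
    have cont: "continuous_on {0..1} (\<lambda>x. \<bar>poly u x\<bar>)" by (intro continuous_intros)
    obtain z where z: "z \<in> {0..1}" "\<And>y. y \<in> {0..1} \<Longrightarrow> \<bar>poly u z\<bar> \<le> \<bar>poly u y\<bar>"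
      using continuous_attains_inf[OF compact_Icc _ cont] by (auto simp: Ball_def)
    define \<epsilon> where "\<epsilon> = \<bar>poly u z\<bar>"
    have \<epsilon>: "\<epsilon> > 0" using no_root[OF z(1)] by (simp add: \<epsilon>_def)
    have sign: "(\<forall>x\<in>{0..1}. 0 < poly u x) \<or> (\<forall>x\<in>{0..1}. poly u x < 0)"
    proof (rule ccontr)
      assume "\<not> ?thesis"
      then obtain a b where ab: "a \<in> {0..1}" "b \<in> {0..1}" "poly u a < 0" "0 < poly u b"
        using no_root by (metis linorder_less_linear)
      have cu: "continuous_on A (poly u)" for A
        using continuous_on_poly[OF continuous_on_id, of A u] by simp
      have "\<exists>x. min a b \<le> x \<and> x \<le> max a b \<and> poly u x = 0"
      proof (cases "a \<le> b")
        case True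
        then show ?thesis using ab IVT'[of "poly u" a 0 b, OF _ _ _ cu] by auto
      next
        case False
        then show ?thesis using ab IVT2'[of "poly u" a 0 b, OF _ _ _ cu] by auto
      qed
      then obtain x where "min a b \<le> x" "x \<le> max a b" "poly u x = 0" by blast
      then show False using no_root[of x] ab by (auto simp: min_def max_def split: if_splits)
    qed
    obtain \<sigma> where "\<forall>x\<in>{0..1}. \<sigma> * poly u x = \<bar>poly u x\<bar>"
      using sign that[of 1] that[of "- 1"] by force
    then have ge: "\<epsilon> \<le> \<sigma> * poly u x" if "x \<in> {0..1}" for x
      using z(2)[OF that] that by (simp add: \<epsilon>_def)
    have "0 \<le> \<Lambda> (smult \<sigma> (u * Q) - smult \<epsilon> Q)"
    proof (rule nonneg)
      fix x :: real assume "0 \<le> x" "x \<le> 1"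
      then have "\<epsilon> * poly Q x \<le> \<sigma> * poly u x * poly Q x"
        by (intro mult_right_mono ge Qx) simp
      then show "0 \<le> poly (smult \<sigma> (u * Q) - smult \<epsilon> Q) x" by simp
    qed
    then have "\<epsilon> * \<Lambda> Q \<le> 0" by (simp add: diff smult Qu)
    with \<epsilon> Q show False by (simp add: mult_le_0_iff)
  qed
  then show ?thesis using deg by (simp add: T_def)
qed

section \<open>Gauss and Gauss-Radau quadrature\<close>

text \<open>The nodes are the zeros of \<open>q\<close>, and the weights are the values of
  \<open>\<Lambda>\<close> at the Lagrange basis. Fewer than \<open>n\<close> nodes can occur when
  \<open>\<Lambda>\<close> is degenerate.\<close>

theorem gauss_quadrature:
  "\<exists>S w. finite S \<and> S \<subseteq> {0..1} \<and> card S \<le> n \<and> (\<forall>z\<in>S. 0 \<le> w z) \<and>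
     (\<forall>p\<in>polys_below (2 * n). \<Lambda> p = (\<Sum>z\<in>S. w z * poly p z))"
proof -
  obtain q where q: "degree q \<le> n" "q \<noteq> 0" "pos_def_below (degree q)"
      "\<And>s. s \<in> polys_below (2 * n - degree q) \<Longrightarrow> \<Lambda> (q * s) = 0"
    using ex_orthogonal_polynomial[of n] by auto
  define S where "S = {x\<in>{0..1}. poly q x = 0}"
  have fin: "finite S" unfolding S_def using poly_roots_finite[OF q(2)] by (rule rev_finite_subset) auto
  have card: "card S = degree q" unfolding S_def
  proof (rule orthogonal_polynomial_roots[OF q(2,3)])
    fix s assume "s \<in> polys_below (degree q)"
    then show "\<Lambda> (q * s) = 0" using q(1) by (intro q(4)) (erule polys_below_mono, simp)
  qed
  obtain L where L: "\<And>z. L z \<in> polys_below (card S)" "\<And>z x. x \<in> S \<Longrightarrow> poly (L z) x = (if x = z then 1 else 0)"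
  proof -
    have "\<forall>z. \<exists>p. p \<in> polys_below (card S) \<and> (\<forall>x\<in>S. poly p x = (if x = z then 1 else 0))"
      using polynomial_interpolation[OF fin] by (intro allI) (simp add: Bex_def)
    then show ?thesis using that by metis
  qed
  define w where "w z = \<Lambda> (L z)" for z
  have quad: "\<Lambda> p = (\<Sum>z\<in>S. w z * poly p z)" if p: "p \<in> polys_below (2 * n)" for p
  proof -
    \<comment> \<open>\<open>\<Lambda>\<close> annihilates the multiple \<open>q * s\<close>, which
      also vanishes at the nodes, so both sides of the formula see only the remainder
      \<open>r\<close>; Lagrange interpolation recovers \<open>r\<close>.\<close>
    define r where "r = p mod q"
    define s where "s = p div q"
    have pq: "p = q * s + r" by (simp add: r_def s_def)
    have r: "r \<in> polys_below (degree q)"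
      using degree_mod_less[OF q(2), of p] by (auto simp: r_def polys_below_iff)
    have "s \<in> polys_below (2 * n - degree q)"
    proof (cases "s = 0")
      case False
      have "degree (q * s) = degree q + degree s" using False q(2) by (simp add: degree_mult_eq)
      moreover have "q * s \<in> polys_below (2 * n)"
        using polys_below_diff[OF p polys_below_mono[OF r]] q(1) by (simp add: pq)
      ultimately show ?thesis using False q(2) by (auto simp: polys_below_iff)
    qed simp
    then have "\<Lambda> p = \<Lambda> r" using q(4) by (simp add: pq add)
    have "r - (\<Sum>z\<in>S. smult (poly p z) (L z)) = 0"
    proof (rule poly_eq_0_if_roots[OF _ fin])
      have "(\<Sum>z\<in>S. smult (poly p z) (L z)) \<in> polys_below (card S)"
        using L(1) by (simp add: polys_below_def coeff_sum)
      then show "r - (\<Sum>z\<in>S. smult (poly p z) (L z)) \<in> polys_below (card S)"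
        using r card by (simp add: polys_below_diff)
    next
      fix x assume x: "x \<in> S"
      have "(\<Sum>z\<in>S. poly p z * poly (L z) x) = (\<Sum>z\<in>S. if z = x then poly p x else 0)"
        using x by (intro sum.cong) (auto simp: L(2))
      then show "poly (r - (\<Sum>z\<in>S. smult (poly p z) (L z))) x = 0"
        using x fin by (simp add: poly_sum pq) (simp add: S_def)
    qed
    then have "\<Lambda> r = (\<Sum>z\<in>S. \<Lambda> (smult (poly p z) (L z)))" by (simp flip: sum)
    then show ?thesis using \<open>\<Lambda> p = \<Lambda> r\<close> by (simp add: smult w_def mult.commute)
  qed
  \<comment> \<open>Exactness at the square of the Lagrange polynomial, of degree below
    \<open>2 * n\<close>, exhibits the weight as the value of \<open>\<Lambda>\<close> at a
    square.\<close>
  moreover have "0 \<le> w z" if z: "z \<in> S" for z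
  proof -
    have "L z \<noteq> 0" using L(2)[OF z, of z] by auto
    then have "degree (L z) < degree q" using L(1)[of z] card by (auto simp: polys_below_iff)
    then have "degree (L z * L z) < 2 * n" using \<open>L z \<noteq> 0\<close> q(1) by (simp add: degree_mult_eq)
    then have "\<Lambda> (L z * L z) = (\<Sum>x\<in>S. w x * poly (L z * L z) x)"
      by (intro quad degree_less_imp_polys_below)
    also have "\<dots> = (\<Sum>x\<in>S. if x = z then w z else 0)"
      by (intro sum.cong) (auto simp: L(2))
    also have "\<dots> = w z" using z fin by simp
    finally show ?thesis using square_nonneg[of "L z"] by simp
  qed
  ultimately show ?thesis using fin card q(1)
    by (intro exI[of _ S] exI[of _ w]) (auto simp: S_def)
qed

text \<open>Gauss quadrature is applied to \<open>\<Lambda>'\<close>, which evaluates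
  \<open>\<Lambda>\<close> at \<open>X\<close> times its argument. Splitting off the constant
  coefficient of \<open>p\<close> turns it into a formula for \<open>\<Lambda>\<close> in which a
  nonzero node has weight \<open>w z / z\<close> and the node 0 takes the remaining mass.\<close>

theorem radau_quadrature:
  "\<exists>S w. finite S \<and> 0 \<in> S \<and> S \<subseteq> {0..1} \<and> card S \<le> Suc n \<and> (\<forall>z\<in>S. 0 \<le> w z) \<and>
     (\<forall>p\<in>polys_below (Suc (2 * n)). \<Lambda> p = (\<Sum>z\<in>S. w z * poly p z))"
proof -
  define \<Lambda>' where "\<Lambda>' p = \<Lambda> ([:0, 1:] * p)" for p
  interpret X: positive_functional \<Lambda>'
  proof
    fix p q :: "real poly" and c :: real
    show "\<Lambda>' (p + q) = \<Lambda>' p + \<Lambda>' q" by (simp only: \<Lambda>'_def distrib_left add)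
    show "\<Lambda>' (smult c p) = c * \<Lambda>' p" by (simp only: \<Lambda>'_def mult_smult_right smult)
    show "0 \<le> \<Lambda>' p" if "\<And>x. 0 \<le> x \<Longrightarrow> x \<le> 1 \<Longrightarrow> 0 \<le> poly p x"
      unfolding \<Lambda>'_def using that by (intro nonneg) simp
  qed
  obtain S w where S: "finite S" "S \<subseteq> {0..1}" "card S \<le> n" "\<And>z. z \<in> S \<Longrightarrow> 0 \<le> w z"
      and quad: "\<And>p. p \<in> polys_below (2 * n) \<Longrightarrow> \<Lambda>' p = (\<Sum>z\<in>S. w z * poly p z)"
    using X.gauss_quadrature[of n] by blast
  define S' where "S' = S - {0}"
  define R where "R = root_poly S'"
  have S': "finite S'" "S' \<subseteq> {0<..1}" "card S' \<le> n"
    using S card_mono[OF S(1), of S'] by (auto simp: S'_def less_le)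
  have R0: "poly R 0 \<noteq> 0" using S' by (simp add: R_def S'_def poly_root_poly_eq_0_iff)
  have RS: "poly R z = 0" if "z \<in> S'" for z using that S' by (simp add: R_def poly_root_poly_eq_0_iff)
  have Rn: "R \<noteq> 0" by (simp add: R_def)
  have degR: "degree (R * R) = 2 * card S'" using Rn by (simp add: degree_mult_eq) (simp add: R_def degree_root_poly)
  \<comment> \<open>Division by the node excludes 0. If the Gauss formula uses 0, one of its at most
    \<open>n\<close> nodes is spent there, so exactness covers \<open>X * R * R\<close>. The value 0
    makes \<open>X * R\<close> a null vector of \<open>\<Lambda>\<close>; hence
    \<open>\<Lambda>' (R * R) = 0\<close>, which isolates the weight at 0.\<close>
  have w0: "w 0 = 0" if "0 \<in> S"
  proof -
    have card: "card S' < n" using that S by (simp add: S'_def) (metis One_nat_def Suc_le_eq Suc_pred card_gt_0_iff empty_iff)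
    have sumS: "(\<Sum>z\<in>S. g z) = g 0 + (\<Sum>z\<in>S'. g z)" for g :: "real \<Rightarrow> real"
      using that S(1) by (simp add: S'_def sum.remove)
    have "degree ([:0, 1:] * (R * R)) < 2 * n"
      using Rn card degR by (subst degree_mult_eq) auto
    then have "\<Lambda>' ([:0, 1:] * (R * R)) = (\<Sum>z\<in>S. w z * poly ([:0, 1:] * (R * R)) z)"
      by (intro quad degree_less_imp_polys_below)
    also have "\<dots> = 0" by (simp add: sumS RS)
    finally have "\<Lambda> (([:0, 1:] * R) * ([:0, 1:] * R)) = 0"
      by (simp only: \<Lambda>'_def ac_simps)
    then have "\<Lambda> (([:0, 1:] * R) * R) = 0" by (rule null_square_orthogonal)
    then have "0 = \<Lambda>' (R * R)" by (simp only: \<Lambda>'_def ac_simps)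
    also have "\<dots> = (\<Sum>z\<in>S. w z * poly (R * R) z)"
      using degR card by (intro quad degree_less_imp_polys_below) simp
    also have "\<dots> = w 0 * (poly R 0)\<^sup>2" by (simp add: sumS RS power2_eq_square)
    finally show ?thesis using R0 by simp
  qed
  \<comment> \<open>The weight at 0 is fixed by exactness for constants.\<close>
  define v where "v z = (if z = 0 then \<Lambda> 1 - (\<Sum>z\<in>S'. w z / z) else w z / z)" for z
  have sumv: "(\<Sum>z\<in>insert 0 S'. v z * g z) = v 0 * g 0 + (\<Sum>z\<in>S'. w z / z * g z)" for g
  proof -
    have "(\<Sum>z\<in>insert 0 S'. v z * g z) = v 0 * g 0 + (\<Sum>z\<in>S'. v z * g z)"
      using S'(1) by (subst sum.insert) (auto simp: S'_def)
    also have "(\<Sum>z\<in>S'. v z * g z) = (\<Sum>z\<in>S'. w z / z * g z)"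
      by (intro sum.cong) (auto simp: S'_def v_def)
    finally show ?thesis .
  qed
  have quad': "\<Lambda> p = (\<Sum>z\<in>insert 0 S'. v z * poly p z)" if p: "p \<in> polys_below (Suc (2 * n))" for p
  proof -
    obtain a p1 where pp: "p = pCons a p1" by (cases p)
    have p1: "p1 \<in> polys_below (2 * n)" using p unfolding pp polys_below_def
      by (auto simp: coeff_pCons split: nat.splits)
    have split: "p = smult a 1 + [:0, 1:] * p1" by (simp add: pp)
    have "\<Lambda> p = a * \<Lambda> 1 + \<Lambda>' p1" unfolding split \<Lambda>'_def by (simp only: add smult)
    also have "\<Lambda>' p1 = (\<Sum>z\<in>S'. w z * poly p1 z)"
      unfolding quad[OF p1] S'_def using S(1) w0 by (cases "0 \<in> S") (simp_all add: sum.remove)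
    also have "\<dots> = (\<Sum>z\<in>S'. w z / z * poly p z) - a * (\<Sum>z\<in>S'. w z / z)"
      unfolding sum_distrib_left sum_subtractf[symmetric]
      by (intro sum.cong) (auto simp: pp S'_def field_simps)
    finally show ?thesis unfolding sumv by (simp add: v_def pp algebra_simps)
  qed
  \<comment> \<open>\<open>R * R\<close> vanishes at all nodes but 0 and has degree at most
    \<open>2 * n\<close>, so it tests the sign of the weight at 0.\<close>
  have "0 \<le> \<Lambda> (R * R)" by (rule square_nonneg)
  also have "\<dots> = (\<Sum>z\<in>insert 0 S'. v z * poly (R * R) z)"
    using degR S'(3) by (intro quad' degree_less_imp_polys_below) simp
  also have "\<dots> = v 0 * (poly R 0)\<^sup>2" unfolding sumv by (simp add: RS power2_eq_square)
  finally have "0 \<le> v 0" using R0 by (simp add: zero_le_mult_iff)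
  then have "\<forall>z\<in>insert 0 S'. 0 \<le> v z" using S S'(2) by (auto simp: v_def S'_def intro!: divide_nonneg_nonneg)
  moreover have "card (insert 0 S') \<le> Suc n" using S' by (metis card_insert_le_m1 card_insert_if Suc_le_mono le_SucI)
  ultimately show ?thesis using S' quad'
    by (intro exI[of _ "insert 0 S'"] exI[of _ v]) (auto simp: S'_def)
qed

end

section \<open>Lower principal representations\<close>

lemma dists01D:
  assumes "F \<in> dists01"
  shows "prob_space F" "sets F = sets borel" "space F = UNIV" "AE x in F. 0 \<le> x \<and> x \<le> 1"
proof -
  show F: "prob_space F" "sets F = sets borel" using assms by (auto simp: dists01_def)
  show sp: "space F = UNIV" using sets_eq_imp_space_eq[OF F(2)] by simp
  have "emeasure F {0..1} = emeasure F (space F)"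
    using assms prob_space.emeasure_space_1[OF F(1)] by (simp add: dists01_def)
  then have "AE x in F. x \<in> {0..1}"
    using F by (intro prob_space.AE_in_set_eq_1[THEN iffD2]) (auto simp: measure_def dists01_def prob_space.emeasure_space_1)
  then show "AE x in F. 0 \<le> x \<and> x \<le> 1" by simp
qed

lemma dists01_integrable_bounded:
  fixes g :: "real \<Rightarrow> real"
  assumes F: "F \<in> dists01" and g: "g \<in> borel_measurable borel"
    and bound: "\<And>x. 0 \<le> x \<Longrightarrow> x \<le> 1 \<Longrightarrow> \<bar>g x\<bar> \<le> B"
  shows "integrable F g"
proof -
  interpret prob_space F by (rule dists01D[OF F])
  show ?thesis
  proof (rule integrable_const_bound)
    show "AE x in F. norm (g x) \<le> B" using dists01D(4)[OF F] by eventually_elim (auto intro: bound)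
    show "g \<in> borel_measurable F" using g measurable_cong_sets[OF dists01D(2)[OF F] refl] by blast
  qed
qed

lemma dists01_integrable_continuous:
  fixes g :: "real \<Rightarrow> real"
  assumes F: "F \<in> dists01" and g: "g \<in> borel_measurable borel" "continuous_on {0..1} g"
  shows "integrable F g"
proof -
  have "compact (g ` {0..1})" by (rule compact_continuous_image[OF g(2) compact_Icc])
  then obtain B where "\<forall>y\<in>g ` {0..1}. norm y \<le> B"
    using compact_imp_bounded bounded_iff by blast
  then show ?thesis by (intro dists01_integrable_bounded[OF F g(1), of B]) auto
qed

lemma borel_measurable_poly [measurable]: "poly p \<in> borel_measurable (borel :: real measure)"
  using continuous_on_poly[OF continuous_on_id, of UNIV p]
  by (intro borel_measurable_continuous_onI) simp

lemma dists01_integrable_poly: "F \<in> dists01 \<Longrightarrow> integrable F (poly p)"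
  using continuous_on_poly[OF continuous_on_id, of "{0..1}" p]
  by (intro dists01_integrable_continuous borel_measurable_poly) simp_all

lemma positive_functional_expectation:
  assumes F: "F \<in> dists01"
  shows "positive_functional (\<lambda>p. \<integral>x. poly p x \<partial>F)"
proof
  show "(\<integral>x. poly (p + q) x \<partial>F) = (\<integral>x. poly p x \<partial>F) + (\<integral>x. poly q x \<partial>F)" for p q
    using dists01_integrable_poly[OF F] by simp
  show "(\<integral>x. poly (smult c p) x \<partial>F) = c * (\<integral>x. poly p x \<partial>F)" for c p
    by simp
  show "0 \<le> (\<integral>x. poly p x \<partial>F)" if "\<And>x. 0 \<le> x \<Longrightarrow> x \<le> 1 \<Longrightarrow> 0 \<le> poly p x" for p
  proof (rule integral_nonneg_AE)
    show "AE x in F. 0 \<le> poly p x" using dists01D(4)[OF F] by eventually_elim (auto intro: that)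
  qed
qed

text \<open>Up to degree \<open>d\<close> expectations depend on the moments alone; later
  comparisons of two members of the class go through this identity.\<close>

lemma expectation_poly_moments:
  assumes F: "F \<in> moment_class d M" and "M 0 = 1" and p: "p \<in> polys_below (Suc d)"
  shows "(\<integral>x. poly p x \<partial>F) = (\<Sum>m\<le>d. coeff p m * M m)"
proof -
  have F': "F \<in> dists01" using F by (simp add: moment_class_def)
  interpret prob_space F by (rule dists01D[OF F'])
  have int: "integrable F (\<lambda>x. x ^ m)" for m
    using dists01_integrable_poly[OF F', of "monom 1 m"] by (simp add: poly_monom[abs_def])
  have mom: "(\<integral>x. x ^ m \<partial>F) = M m" if "m \<le> d" for m
    using that F \<open>M 0 = 1\<close> by (cases m) (auto simp: moment_class_def prob_space simp del: power_Suc)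
  have "degree p \<le> d" using p by (auto simp: polys_below_iff)
  then have "poly p x = (\<Sum>m\<le>d. coeff p m * x ^ m)" for x
    unfolding poly_altdef by (intro sum.mono_neutral_left) (auto simp: coeff_eq_0)
  then have "(\<integral>x. poly p x \<partial>F) = (\<Sum>m\<le>d. coeff p m * (\<integral>x. x ^ m \<partial>F))"
    using int by simp
  then show ?thesis by (simp add: mom)
qed

section \<open>Finite sums of point masses\<close>

text \<open>As the image of a point measure on the indices it turns integrals into finite sums, and
  coinciding nodes simply add their weights.\<close>

definition point_masses :: "nat \<Rightarrow> (nat \<Rightarrow> real) \<Rightarrow> (nat \<Rightarrow> real) \<Rightarrow> real measure" where
  "point_masses l f x = distr (point_measure {1..l} (\<lambda>i. ennreal (f i))) borel x"

lemma emeasure_point_masses: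
  assumes "A \<in> sets borel"
  shows "emeasure (point_masses l f x) A = (\<Sum>i=1..l. ennreal (f i) * indicator A (x i))"
proof -
  have "emeasure (point_masses l f x) A = (\<Sum>i\<in>x -` A \<inter> {1..l}. ennreal (f i))"
    unfolding point_masses_def using assms
    by (subst emeasure_distr) (auto simp: space_point_measure emeasure_point_measure_finite)
  also have "\<dots> = (\<Sum>i=1..l. ennreal (f i) * indicator A (x i))"
    by (rule sum.mono_neutral_cong_left) (auto simp: indicator_def)
  finally show ?thesis .
qed

lemma is_point_mass_sum_iff: "is_point_mass_sum F l f x \<longleftrightarrow> F = point_masses l f x"
proof
  assume F: "is_point_mass_sum F l f x"
  show "F = point_masses l f x"
  proof (rule measure_eqI)
    show "sets F = sets (point_masses l f x)" using F by (simp add: is_point_mass_sum_def point_masses_def)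
    show "emeasure F A = emeasure (point_masses l f x) A" if "A \<in> sets F" for A
      using F that by (simp add: is_point_mass_sum_def emeasure_point_masses)
  qed
qed (simp add: is_point_mass_sum_def emeasure_point_masses, simp add: point_masses_def)

lemma integral_point_masses:
  fixes g :: "real \<Rightarrow> real"
  assumes "g \<in> borel_measurable borel" "\<And>i. i \<in> {1..l} \<Longrightarrow> 0 \<le> f i"
  shows "(\<integral>y. g y \<partial>point_masses l f x) = (\<Sum>i=1..l. f i * g (x i))"
  unfolding point_masses_def using assms
  by (subst integral_distr, simp, simp, subst lebesgue_integral_point_measure_finite) auto

section \<open>Uniqueness and existence of the lower principal representation\<close>

text \<open>The expression for \<open>l\<close> in \<open>is_lower_rep\<close> is kept verbatim so
  that it can be folded there.\<close>

definition node_count :: "nat \<Rightarrow> nat" where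
  "node_count d = nat \<lceil>(real d + 1) / 2\<rceil>"

lemma node_count_eq: "node_count d = Suc (d div 2)"
proof -
  have "\<lceil>(real d + 1) / 2\<rceil> = int (Suc (d div 2))"
  proof (cases "even d")
    case True
    then obtain k where "d = 2 * k" by blast
    then show ?thesis by (simp add: ceiling_unique field_simps)
  next
    case False
    then obtain k where "d = 2 * k + 1" by (blast elim: oddE)
    then show ?thesis by (simp add: ceiling_unique field_simps)
  qed
  then show ?thesis by (simp add: node_count_def)
qed

text \<open>The two parities share their moment equations and differ only in the node at 0, so they
  are merged. Of the ordering of the nodes only their location in the unit interval is
  retained.\<close>

lemma is_lower_repE:
  assumes "is_lower_rep d M F"
  obtains f x where "F \<in> dists01" "F = point_masses (node_count d) f x"
    "x ` {1..node_count d} \<subseteq> {0..1}"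
    "\<And>i. i \<in> {1..node_count d} \<Longrightarrow> 0 \<le> f i"
    "\<And>m. m \<le> d \<Longrightarrow> (\<Sum>i=1..node_count d. f i * x i ^ m) = M m"
    "even d \<Longrightarrow> x 1 = 0"
proof -
  obtain f x where *: "F \<in> dists01" "is_point_mass_sum F (node_count d) f x"
      "0 \<le> x 1" "strict_mono_on {1..node_count d} x" "x (node_count d) \<le> 1"
      "\<forall>i\<in>{1..node_count d}. 0 \<le> f i"
      "\<forall>m\<in>{0..d}. (\<Sum>i=1..node_count d. f i * x i ^ m) = M m" "even d \<longrightarrow> x 1 = 0"
    using assms unfolding is_lower_rep_def Let_def node_count_def[symmetric] by (cases "even d") auto
  have "x ` {1..node_count d} \<subseteq> {0..1}"
  proof
    fix y assume "y \<in> x ` {1..node_count d}"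
    then obtain i where i: "i \<in> {1..node_count d}" "y = x i" by auto
    then have "x 1 \<le> x i" "x i \<le> x (node_count d)"
      using strict_mono_on_leD[OF *(4), of 1 i] strict_mono_on_leD[OF *(4), of i "node_count d"] by auto
    then show "y \<in> {0..1}" using i *(3,5) by auto
  qed
  then show ?thesis
    using * by (intro that[of f x]) (auto simp: is_point_mass_sum_iff simp del: One_nat_def)
qed

lemma is_lower_rep_moment_class:
  assumes "is_lower_rep d M F"
  shows "F \<in> moment_class d M"
  using assms
proof (rule is_lower_repE)
  fix f x
  assume *: "F \<in> dists01" "F = point_masses (node_count d) f x"
    "\<And>i. i \<in> {1..node_count d} \<Longrightarrow> 0 \<le> f i"
    "\<And>m. m \<le> d \<Longrightarrow> (\<Sum>i=1..node_count d. f i * x i ^ m) = M m"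
  have "(\<integral>y. y ^ m \<partial>F) = M m" if "m \<le> d" for m
    using *(4)[OF that] *(3) unfolding *(2) by (subst integral_point_masses) auto
  then show ?thesis using *(1) by (simp add: moment_class_def)
qed

lemma is_lower_rep_unique:
  assumes "M 0 = 1" and F: "is_lower_rep d M F" and G: "is_lower_rep d M G"
  shows "F = G"
proof -
  let ?I = "{1..node_count d}"
  obtain f x where f: "F \<in> dists01" "F = point_masses (node_count d) f x"
      "\<And>i. i \<in> ?I \<Longrightarrow> 0 \<le> f i" "even d \<Longrightarrow> x 1 = 0"
    using is_lower_repE[OF F] by metis
  obtain g y where g: "G \<in> dists01" "G = point_masses (node_count d) g y"
      "\<And>i. i \<in> ?I \<Longrightarrow> 0 \<le> g i" "even d \<Longrightarrow> y 1 = 0"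
    using is_lower_repE[OF G] by metis
  have FM: "F \<in> moment_class d M" and GM: "G \<in> moment_class d M"
    using F G by (simp_all add: is_lower_rep_moment_class)
  define S where "S = x ` ?I \<union> y ` ?I"
  have fin: "finite S" by (simp add: S_def)
  \<comment> \<open>For odd \<open>d\<close> there are twice \<open>(d + 1) / 2\<close> nodes; for
    even \<open>d\<close> twice \<open>d / 2 + 1\<close>, less one because the node 0 is shared.
    Both counts give \<open>d + 1\<close>.\<close>
  have card: "card S \<le> Suc d"
  proof (cases "even d")
    case False
    have "card S \<le> card (x ` ?I) + card (y ` ?I)" unfolding S_def by (rule card_Un_le)
    also have "\<dots> \<le> node_count d + node_count d"
      using card_image_le[of ?I x] card_image_le[of ?I y] by simp
    also have "\<dots> \<le> Suc d" using False by (auto simp: node_count_eq elim!: oddE)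
    finally show ?thesis .
  next
    case True
    have 1: "1 \<in> ?I" by (simp add: node_count_eq)
    have "S = x ` ?I \<union> y ` (?I - {1})"
      using 1 f(4)[OF True] g(4)[OF True] unfolding S_def by (auto simp: image_iff simp del: One_nat_def)
    then have "card S \<le> card (x ` ?I) + card (y ` (?I - {1}))" by (metis card_Un_le)
    also have "\<dots> \<le> node_count d + (node_count d - 1)"
      using card_image_le[of ?I x] card_image_le[of "?I - {1}" y] 1 by simp
    also have "\<dots> \<le> Suc d" using True by (auto simp: node_count_eq elim!: evenE)
    finally show ?thesis .
  qed
  show ?thesis
  proof (rule measure_eqI)
    show "sets F = sets G" using f(1) g(1) by (simp add: dists01D)
    fix A assume "A \<in> sets F"
    then have A: "A \<in> sets borel" using f(1) by (simp add: dists01D)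
    \<comment> \<open>On \<open>S\<close>, which carries both measures, the indicator of an
      arbitrary Borel set agrees with a polynomial of admissible degree.\<close>
    obtain p where p: "p \<in> polys_below (card S)" "\<forall>z\<in>S. poly p z = indicator A z"
      using polynomial_interpolation[OF fin, of "indicator A"] by blast
    have pd: "p \<in> polys_below (Suc d)" using p(1) card by (rule polys_below_mono)
    interpret F: prob_space F by (rule dists01D[OF f(1)])
    interpret G: prob_space G by (rule dists01D[OF g(1)])
    have "measure F A = (\<integral>z. indicator A z \<partial>F)" using A f(1) by (simp add: dists01D)
    also have "\<dots> = (\<integral>z. poly p z \<partial>F)"
      unfolding f(2) using f(3) A p(2)
      by (subst (1 2) integral_point_masses) (auto simp: S_def intro!: sum.cong)
    also have "\<dots> = (\<integral>z. poly p z \<partial>G)"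
      using expectation_poly_moments[OF FM \<open>M 0 = 1\<close> pd] expectation_poly_moments[OF GM \<open>M 0 = 1\<close> pd] by simp
    also have "\<dots> = (\<integral>z. indicator A z \<partial>G)"
      unfolding g(2) using g(3) A p(2)
      by (subst (1 2) integral_point_masses) (auto simp: S_def intro!: sum.cong)
    also have "\<dots> = measure G A" using A g(1) by (simp add: dists01D)
    finally show "emeasure F A = emeasure G A" by (simp add: F.emeasure_eq_measure G.emeasure_eq_measure)
  qed
qed

text \<open>Quadrature may supply too few nodes, so arbitrary further points of the interval are
  added with weight zero before the nodes are sorted.\<close>

lemma quadrature_imp_is_lower_rep:
  assumes "M 0 = 1"
    and S: "finite S" "S \<subseteq> {0..1}" "card S \<le> node_count d" "\<And>z. z \<in> S \<Longrightarrow> 0 \<le> w z"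
    and zero: "even d \<Longrightarrow> 0 \<in> S"
    and moments: "\<And>m. m \<le> d \<Longrightarrow> (\<Sum>z\<in>S. w z * z ^ m) = M m"
  shows "\<exists>F. is_lower_rep d M F"
proof -
  define l where "l = node_count d"
  have l: "1 \<le> l" by (simp add: l_def node_count_eq)
  have "infinite ({0..1} - S :: real set)" using S(1) infinite_Icc[of "0::real" 1]
    by (intro Diff_infinite_finite) simp_all
  then obtain T where T: "finite T" "T \<subseteq> {0..1} - S" "card T = l - card S"
    using infinite_arbitrarily_large[of "{0..1} - S" "l - card S"] by blast
  define U where "U = S \<union> T"
  have U: "finite U" "U \<subseteq> {0..1}" "card U = l"
    using S T card_Un_disjoint[of S T] by (auto simp: U_def l_def)
  define x where "x i = sorted_list_of_set U ! (i - 1)" for i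
  have len: "length (sorted_list_of_set U) = l" using U by simp
  have mono: "strict_mono_on {1..l} x"
    using sorted_wrt_nth_less[OF strict_sorted_list_of_set[of U]] len
    by (intro strict_mono_onI) (auto simp: x_def)
  have img: "x ` {1..l} = U"
  proof -
    have "x ` {1..l} = (\<lambda>i. sorted_list_of_set U ! i) ` {0..<l}"
      unfolding x_def by (force simp: image_iff intro: bexI[of _ "Suc _"])
    also have "\<dots> = set (sorted_list_of_set U)"
      using len by (auto simp: set_conv_nth)
    finally show ?thesis using U(1) by simp
  qed
  define f where "f i = (if x i \<in> S then w (x i) else 0)" for i
  have f0: "0 \<le> f i" for i by (simp add: f_def S(4))
  have sums: "(\<Sum>i=1..l. f i * g (x i)) = (\<Sum>z\<in>S. w z * g z)" for g
  proof -
    have "(\<Sum>i=1..l. f i * g (x i)) = (\<Sum>z\<in>U. (if z \<in> S then w z else 0) * g z)"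
      unfolding img[symmetric] sum.reindex[OF strict_mono_on_imp_inj_on[OF mono]] by (simp add: f_def)
    also have "\<dots> = (\<Sum>z\<in>S. w z * g z)"
      using U(1) by (intro sum.mono_neutral_cong_right) (auto simp: U_def)
    finally show ?thesis .
  qed
  have mom: "(\<Sum>i=1..l. f i * x i ^ m) = M m" if "m \<le> d" for m
    using sums[of "\<lambda>z. z ^ m"] moments[OF that] by simp
  have x01: "0 \<le> x i \<and> x i \<le> 1" if "i \<in> {1..l}" for i
  proof -
    have "x i \<in> U" using that img by blast
    then show ?thesis using U(2) by auto
  qed
  have tot: "(\<Sum>i=1..l. ennreal (f i)) = 1" using mom[of 0] f0 \<open>M 0 = 1\<close> by simp
  have "point_masses l f x \<in> dists01"
  proof -
    have "emeasure (point_masses l f x) A = 1" if "A \<in> sets borel" "{0..1} \<subseteq> A" for A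
    proof -
      have "x i \<in> A" if "i \<in> {1..l}" for i using x01[OF that] \<open>{0..1} \<subseteq> A\<close> by auto
      then show ?thesis using that tot by (simp add: emeasure_point_masses)
    qed
    from this[of UNIV] this[of "{0..1}"] show ?thesis
      unfolding dists01_def by (auto simp: point_masses_def intro!: prob_spaceI)
  qed
  moreover have "x 1 = 0" if "even d"
  proof -
    have "0 \<in> x ` {1..l}" using img zero[OF that] by (auto simp: U_def)
    then obtain i where i: "i \<in> {1..l}" "x i = 0" by auto
    then have "x 1 \<le> 0" using strict_mono_on_leD[OF mono, of 1 i] l by auto
    then show ?thesis using x01[of 1] l by simp
  qed
  ultimately have "is_lower_rep d M (point_masses l f x)"
    unfolding is_lower_rep_def Let_def node_count_def[symmetric] l_def[symmetric]
    using mono x01[of 1] x01[of l] l f0 mom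
    by (intro conjI exI[of _ f] exI[of _ x]) (simp_all add: is_point_mass_sum_iff)
  then show ?thesis by blast
qed

text \<open>Radau quadrature with \<open>n = d / 2\<close> for even \<open>d\<close> and Gauss
  quadrature with \<open>n = (d + 1) / 2\<close> for odd \<open>d\<close> are both exact up to
  degree \<open>d\<close>.\<close>

lemma ex_lower_rep:
  assumes "M 0 = 1" "F \<in> moment_class d M"
  shows "\<exists>F. is_lower_rep d M F"
proof -
  have F: "F \<in> dists01" using assms by (simp add: moment_class_def)
  define \<Lambda> where "\<Lambda> p = (\<integral>x. poly p x \<partial>F)" for p
  interpret positive_functional \<Lambda>
    using positive_functional_expectation[OF F] by (simp add: \<Lambda>_def[abs_def])
  have mom: "\<Lambda> (monom 1 m) = M m" if "m \<le> d" for m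
  proof -
    have "monom 1 m \<in> polys_below (Suc d)" using that by (simp add: polys_below_def)
    then have "\<Lambda> (monom 1 m) = (\<Sum>k\<le>d. coeff (monom 1 m) k * M k)"
      unfolding \<Lambda>_def by (rule expectation_poly_moments[OF assms(2,1)])
    also have "\<dots> = (\<Sum>k\<le>d. if k = m then M m else 0)" by (intro sum.cong) auto
    finally show ?thesis using that by simp
  qed
  have "\<exists>S w. finite S \<and> S \<subseteq> {0..1} \<and> card S \<le> node_count d \<and> (\<forall>z\<in>S. 0 \<le> w z) \<and> (even d \<longrightarrow> 0 \<in> S) \<and>
     (\<forall>p\<in>polys_below (Suc d). \<Lambda> p = (\<Sum>z\<in>S. w z * poly p z))"
  proof (cases "even d")
    case True
    then obtain n where n: "d = 2 * n" by blast
    then show ?thesis using radau_quadrature[of n] by (auto simp: node_count_eq)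
  next
    case False
    then obtain n where n: "d = 2 * n + 1" by (blast elim: oddE)
    then show ?thesis using gauss_quadrature[of "Suc n"] by (auto simp: node_count_eq)
  qed
  then obtain S w where S: "finite S" "S \<subseteq> {0..1}" "card S \<le> node_count d" "\<forall>z\<in>S. 0 \<le> w z" "even d \<longrightarrow> 0 \<in> S"
      "\<forall>p\<in>polys_below (Suc d). \<Lambda> p = (\<Sum>z\<in>S. w z * poly p z)" by blast
  have "(\<Sum>z\<in>S. w z * z ^ m) = M m" if m: "m \<le> d" for m
  proof -
    have "monom 1 m \<in> polys_below (Suc d)" using m by (simp add: polys_below_def)
    then show ?thesis using S(6) mom[OF m] by (simp add: poly_monom)
  qed
  then show ?thesis using S by (intro quadrature_imp_is_lower_rep[of M S d w, OF assms(1)]) auto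
qed

section \<open>Comparison of the dual objectives\<close>

lemma dists01_integrable_resolvent:
  assumes "F \<in> dists01" "1 < A"
  shows "integrable F (\<lambda>y. 1 / (A - y))"
  using assms by (intro dists01_integrable_continuous) (auto intro!: continuous_intros)

text \<open>Here the interpolation polynomial of \<open>y \<mapsto> 1 / (A - y)\<close> at the zeros of \<open>W\<close>, multiplicities
  included, is explicitly \<open>(1 - W y / W A) / (A - y)\<close>.\<close>

lemma expectation_resolvent_lower_rep:
  assumes "M 0 = 1" and F\<^sub>0: "is_lower_rep d M F\<^sub>0" and F: "F \<in> moment_class d M" and A: "1 < A"
  shows "(\<integral>y. 1 / (A - y) \<partial>F\<^sub>0) \<le> (\<integral>y. 1 / (A - y) \<partial>F)"
proof -
  let ?l = "node_count d"
  obtain f x where f: "F\<^sub>0 \<in> dists01" "F\<^sub>0 = point_masses ?l f x" "x ` {1..?l} \<subseteq> {0..1}"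
      "\<And>i. i \<in> {1..?l} \<Longrightarrow> 0 \<le> f i" "even d \<Longrightarrow> x 1 = 0"
    using is_lower_repE[OF F\<^sub>0] by metis
  have F1: "F \<in> dists01" using F by (simp add: moment_class_def)
  \<comment> \<open>For even \<open>d\<close> the node 0 enters \<open>W\<close> as a simple factor,
    which is nonnegative on the interval by itself; the other nodes enter as squares. Thus
    \<open>W\<close> has degree at most \<open>d + 1\<close>, is nonnegative on the interval and
    vanishes at every node.\<close>
  define I where "I = (if even d then {1..?l} - {1} else {1..?l})"
  define R where "R = root_poly (x ` I)"
  define W where "W = (if even d then [:0, 1:] * (R * R) else R * R)"
  have finI: "finite I" by (simp add: I_def)
  have R0: "R \<noteq> 0" by (simp add: R_def)
  have "degree R \<le> card I" using card_image_le[OF finI, of x] by (simp add: R_def degree_root_poly)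
  then have "degree (R * R) \<le> 2 * card I" using R0 by (simp add: degree_mult_eq)
  then have degW: "degree W \<le> Suc d"
  proof (cases "even d")
    case True
    have "degree W \<le> degree [:0, 1::real:] + degree (R * R)"
      using True unfolding W_def by (simp only: if_True degree_mult_le)
    with \<open>degree (R * R) \<le> 2 * card I\<close> show ?thesis using True
      by (auto simp: I_def node_count_eq elim!: evenE)
  next
    case False
    with \<open>degree (R * R) \<le> 2 * card I\<close> show ?thesis
      by (auto simp: W_def I_def node_count_eq elim!: oddE)
  qed
  have W_nonneg: "0 \<le> poly W y" if "0 \<le> y" for y using that by (simp add: W_def)
  have W_node: "poly W (x i) = 0" if "i \<in> {1..?l}" for i
  proof (cases "i \<in> I")
    case True
    then have "poly R (x i) = 0" using finI by (simp add: R_def poly_root_poly_eq_0_iff)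
    then show ?thesis by (simp add: W_def)
  next
    case False
    then have "even d" "i = 1" using that by (auto simp: I_def split: if_splits)
    then show ?thesis using f(5) by (simp add: W_def)
  qed
  have "A \<notin> x ` I" using f(3) A by (auto simp: I_def split: if_splits)
  then have "poly R A \<noteq> 0" using finI by (simp add: R_def poly_root_poly_eq_0_iff)
  then have WA: "0 < poly W A" using A by (auto simp: W_def zero_less_mult_iff linorder_neq_iff)
  have "poly (W - [:poly W A:]) A = 0" by simp
  \<comment> \<open>Dividing by \<open>X - A\<close> lowers the degree to at most \<open>d\<close>,
    where the moments determine expectations.\<close>
  then obtain V where V: "W - [:poly W A:] = [:- A, 1:] * V" by (auto simp only: poly_eq_0_iff_dvd elim: dvdE)
  define p where "p = smult (1 / poly W A) V"
  have "V \<in> polys_below (Suc d)"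
  proof (cases "V = 0")
    case False
    then have "Suc (degree V) = degree (W - [:poly W A:])" using V degree_linear_mult[of V A] by simp
    also have "\<dots> \<le> Suc d" using degW by (intro degree_diff_le) auto
    finally show ?thesis by (intro degree_less_imp_polys_below) simp
  qed simp
  then have p: "p \<in> polys_below (Suc d)" unfolding p_def by (rule polys_below_smult)
  \<comment> \<open>The last summand is the interpolation error: zero at the nodes and nonnegative
    on the interval.\<close>
  have eq: "1 / (A - y) = poly p y + poly W y / (poly W A * (A - y))" if "y \<le> 1" for y
  proof -
    have "poly W y - poly W A = (y - A) * poly V y" using arg_cong[OF V, of "\<lambda>q. poly q y"] by (simp add: algebra_simps)
    then have "poly V y = (poly W A - poly W y) / (A - y)" using that A by (simp add: field_simps)
    moreover have "1 / e = 1 / w * ((w - v) / e) + v / (w * e)" if "e \<noteq> 0" "w \<noteq> 0" for e v w :: real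
      using that by (simp add: field_simps)
    ultimately show ?thesis using WA that A by (simp add: p_def)
  qed
  have "(\<integral>y. 1 / (A - y) \<partial>F\<^sub>0) = (\<integral>y. poly p y \<partial>F\<^sub>0)"
  proof -
    have "(\<Sum>i=1..?l. f i * (1 / (A - x i))) = (\<Sum>i=1..?l. f i * poly p (x i))"
    proof (intro sum.cong refl)
      fix i assume i: "i \<in> {1..?l}"
      have "x i \<in> {0..1}" using f(3) i by blast
      then have "x i \<le> 1" by simp
      then show "f i * (1 / (A - x i)) = f i * poly p (x i)" using eq[of "x i"] W_node[OF i] by simp
    qed
    then show ?thesis unfolding f(2) using f(4) by (subst (1 2) integral_point_masses) simp_all
  qed
  also have "\<dots> = (\<integral>y. poly p y \<partial>F)"
    using expectation_poly_moments[OF F \<open>M 0 = 1\<close> p]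
      expectation_poly_moments[OF is_lower_rep_moment_class[OF F\<^sub>0] \<open>M 0 = 1\<close> p] by simp
  also have "\<dots> \<le> (\<integral>y. 1 / (A - y) \<partial>F)"
  proof (rule integral_mono_AE)
    show "integrable F (poly p)" by (rule dists01_integrable_poly[OF F1])
    show "integrable F (\<lambda>y. 1 / (A - y))" by (rule dists01_integrable_resolvent[OF F1 A])
    show "AE y in F. poly p y \<le> 1 / (A - y)"
      using dists01D(4)[OF F1]
    proof eventually_elim
      case (elim y)
      then have "0 \<le> poly W y / (poly W A * (A - y))" using WA A W_nonneg[of y] by simp
      then show ?case using eq[of y] elim by simp
    qed
  qed
  finally show ?thesis .
qed

section \<open>The dual objective and its derivative\<close>

definition dual_objective :: "real measure \<Rightarrow> real \<Rightarrow> real \<Rightarrow> real" where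
  "dual_objective F \<mu> \<nu> = (\<integral>x. ln (1 - (x - \<mu>) * \<nu>) \<partial>F)"

text \<open>An affine function of \<open>x\<close> is smallest at an end of the interval; the sign
  of \<open>\<nu>\<close> decides at which one.\<close>

lemma affine_ge_min:
  fixes x \<mu> \<nu> :: real
  assumes "0 \<le> x" "x \<le> 1"
  shows "min (1 + \<mu> * \<nu>) (1 - (1 - \<mu>) * \<nu>) \<le> 1 - (x - \<mu>) * \<nu>"
proof (cases "0 \<le> \<nu>")
  case True
  then have "x * \<nu> \<le> \<nu>" using assms by (simp add: mult_left_le_one_le)
  then show ?thesis by (simp add: algebra_simps min_le_iff_disj)
next
  case False
  then have "x * \<nu> \<le> 0" using assms by (simp add: mult_nonneg_nonpos)
  then show ?thesis by (simp add: algebra_simps min_le_iff_disj)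
qed

text \<open>The conditions on \<open>\<nu>\<close> say that the argument of the logarithm is
  positive at \<open>x = 0\<close> and \<open>x = 1\<close>. They are open and admit slightly
  negative \<open>\<nu>\<close>, so that \<open>\<nu> = 0\<close> has a two-sided
  derivative.\<close>

locale dual_param =
  fixes F :: "real measure" and \<mu> \<nu> :: real
  assumes F: "F \<in> dists01" and \<mu>: "0 \<le> \<mu>" "\<mu> < 1"
    and \<nu>: "0 < 1 + \<mu> * \<nu>" "0 < 1 - (1 - \<mu>) * \<nu>"
begin

lemma affine_pos: "0 \<le> x \<Longrightarrow> x \<le> 1 \<Longrightarrow> 0 < 1 - (x - \<mu>) * \<nu>"
  using affine_ge_min[of x \<mu> \<nu>] \<nu> by simp

lemma integrable_ln_affine: "integrable F (\<lambda>x. ln (1 - (x - \<mu>) * \<nu>))"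
proof (rule dists01_integrable_continuous[OF F])
  have "1 - (x - \<mu>) * \<nu> \<noteq> 0" if "x \<in> {0..1}" for x using affine_pos[of x] that by auto
  then show "continuous_on {0..1} (\<lambda>x. ln (1 - (x - \<mu>) * \<nu>))" by (intro continuous_intros) auto
qed simp

lemma integrable_divide_affine: "integrable F (\<lambda>x. (a + b * x) / (1 - (x - \<mu>) * \<nu>))"
proof (rule dists01_integrable_continuous[OF F])
  have "1 - (x - \<mu>) * \<nu> \<noteq> 0" if "x \<in> {0..1}" for x using affine_pos[of x] that by auto
  then show "continuous_on {0..1} (\<lambda>x. (a + b * x) / (1 - (x - \<mu>) * \<nu>))" by (intro continuous_intros) auto
qed simp

lemma integrable_slope: "integrable F (\<lambda>x. (x - \<mu>) / (1 - (x - \<mu>) * \<nu>))"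
  using integrable_divide_affine[of "- \<mu>" 1] by simp

lemma integrable_inverse: "integrable F (\<lambda>x. 1 / (1 - (x - \<mu>) * \<nu>))"
  using integrable_divide_affine[of 1 0] by simp

text \<open>Integrates \<open>1 / a - 1 = (1 - a) / a\<close> for
  \<open>a = 1 - (x - \<mu>) * \<nu>\<close>. It expresses the slope of the dual objective through
  the expectation to which Markov's inequality applies, and which is also the mass of the tilted
  measure.\<close>

lemma slope_eq:
  "\<nu> * (\<integral>x. (x - \<mu>) / (1 - (x - \<mu>) * \<nu>) \<partial>F) = (\<integral>x. 1 / (1 - (x - \<mu>) * \<nu>) \<partial>F) - 1"
proof -
  interpret prob_space F by (rule dists01D[OF F])
  note [measurable_cong] = dists01D(2)[OF F]
  have "(\<integral>x. 1 / (1 - (x - \<mu>) * \<nu>) \<partial>F) - 1 = (\<integral>x. 1 / (1 - (x - \<mu>) * \<nu>) - 1 \<partial>F)"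
    using integrable_inverse by (simp add: prob_space)
  also have "\<dots> = (\<integral>x. \<nu> * ((x - \<mu>) / (1 - (x - \<mu>) * \<nu>)) \<partial>F)"
  proof (rule integral_cong_AE)
    show "AE x in F. 1 / (1 - (x - \<mu>) * \<nu>) - 1 = \<nu> * ((x - \<mu>) / (1 - (x - \<mu>) * \<nu>))"
      using dists01D(4)[OF F]
    proof eventually_elim
      case (elim x)
      then show ?case using affine_pos[of x] by (simp add: field_simps)
    qed
  qed measurable
  finally show ?thesis by (simp only: integral_mult_right_zero)
qed

end

text \<open>Both bounds come from \<open>ln t \<le> t - 1\<close>, at \<open>t = b / a\<close> and
  at \<open>t = a / b\<close>; the right-hand side is the sum of the two upper bounds.\<close>

lemma ln_first_order_error:
  fixes a b :: real
  assumes "0 < a" "0 < b"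
  shows "\<bar>ln b - ln a - (b - a) / a\<bar> \<le> (b - a)\<^sup>2 / (a * b)"
proof -
  have "ln b - ln a \<le> b / a - 1" using ln_le_minus_one[of "b / a"] assms by (simp add: ln_div)
  moreover have "ln a - ln b \<le> a / b - 1" using ln_le_minus_one[of "a / b"] assms by (simp add: ln_div)
  moreover have "(b - a)\<^sup>2 / (a * b) = (b / a - 1) + (a / b - 1)"
    using assms by (simp add: field_simps power2_eq_square)
  moreover have "(b - a) / a = b / a - 1" using assms by (simp add: field_simps)
  ultimately show ?thesis by linarith
qed

text \<open>Differentiation under the integral: the first-order remainder of the logarithm is
  quadratic in the increment, uniformly in \<open>x\<close>.\<close>

lemma (in dual_param) DERIV_dual_objective:
  "(dual_objective F \<mu> has_real_derivative - (\<integral>x. (x - \<mu>) / (1 - (x - \<mu>) * \<nu>) \<partial>F)) (at \<nu>)"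
proof -
  interpret prob_space F by (rule dists01D[OF F])
  \<comment> \<open>Half the minimum of the affine function on the interval: since
    \<open>\<bar>x - \<mu>\<bar> \<le> 1\<close>, an increment of at most \<open>\<delta>\<close>
    leaves the perturbed function at least \<open>\<delta>\<close>.\<close>
  define \<delta> where "\<delta> = min (1 + \<mu> * \<nu>) (1 - (1 - \<mu>) * \<nu>) / 2"
  have \<delta>: "0 < \<delta>" using \<nu> by (simp add: \<delta>_def)
  let ?L = "dual_objective F \<mu>"
  let ?D = "- (\<integral>x. (x - \<mu>) / (1 - (x - \<mu>) * \<nu>) \<partial>F)"
  have est: "\<bar>(?L (\<nu> + \<eta>) - ?L \<nu>) / \<eta> - ?D\<bar> \<le> \<bar>\<eta>\<bar> / \<delta>\<^sup>2" if \<eta>: "\<bar>\<eta>\<bar> \<le> \<delta>" "\<eta> \<noteq> 0" for \<eta>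
  proof -
    have small: "\<bar>t * \<eta>\<bar> \<le> \<delta>" if "\<bar>t\<bar> \<le> 1" for t
    proof -
      have "\<bar>t\<bar> * \<bar>\<eta>\<bar> \<le> 1 * \<bar>\<eta>\<bar>" using that by (intro mult_right_mono) simp_all
      then show ?thesis using \<eta>(1) by (simp add: abs_mult)
    qed
    interpret \<eta>: dual_param F \<mu> "\<nu> + \<eta>"
    proof
      have "1 + \<mu> * \<nu> \<ge> 2 * \<delta>" "1 - (1 - \<mu>) * \<nu> \<ge> 2 * \<delta>" by (simp_all add: \<delta>_def)
      then show "0 < 1 + \<mu> * (\<nu> + \<eta>)" "0 < 1 - (1 - \<mu>) * (\<nu> + \<eta>)"
        using small[of \<mu>] small[of "1 - \<mu>"] \<mu> \<delta> by (auto simp: distrib_left abs_le_iff)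
    qed (use F \<mu> in auto)
    have "?L (\<nu> + \<eta>) - ?L \<nu> - \<eta> * ?D =
        (\<integral>x. ln (1 - (x - \<mu>) * (\<nu> + \<eta>)) - ln (1 - (x - \<mu>) * \<nu>) + \<eta> * ((x - \<mu>) / (1 - (x - \<mu>) * \<nu>)) \<partial>F)"
      unfolding dual_objective_def
      using \<eta>.integrable_ln_affine integrable_ln_affine integrable_slope
      by (simp del: times_divide_eq_right)
    also have "\<bar>\<dots>\<bar> \<le> \<eta>\<^sup>2 / \<delta>\<^sup>2"
    proof -
      have "AE x in F. \<bar>ln (1 - (x - \<mu>) * (\<nu> + \<eta>)) - ln (1 - (x - \<mu>) * \<nu>) + \<eta> * ((x - \<mu>) / (1 - (x - \<mu>) * \<nu>))\<bar> \<le> \<eta>\<^sup>2 / \<delta>\<^sup>2"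
        using dists01D(4)[OF F]
      proof eventually_elim
        case (elim x)
        define a where "a = 1 - (x - \<mu>) * \<nu>"
        define b where "b = 1 - (x - \<mu>) * (\<nu> + \<eta>)"
        have ba: "b - a = - ((x - \<mu>) * \<eta>)" by (simp add: a_def b_def algebra_simps)
        have x: "\<bar>x - \<mu>\<bar> \<le> 1" using elim \<mu> by (simp add: abs_le_iff)
        have a: "2 * \<delta> \<le> a" using affine_ge_min[of x \<mu> \<nu>] elim by (simp add: a_def \<delta>_def)
        then have b: "\<delta> \<le> b" using ba small[OF x] by simp
        have "(b - a)\<^sup>2 / (a * b) \<le> \<eta>\<^sup>2 / \<delta>\<^sup>2"
        proof (rule frac_le)
          have "(x - \<mu>)\<^sup>2 \<le> 1" using x by (simp add: abs_square_le_1)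
          then have "(x - \<mu>)\<^sup>2 * \<eta>\<^sup>2 \<le> 1 * \<eta>\<^sup>2" by (rule mult_right_mono) simp
          then show "(b - a)\<^sup>2 \<le> \<eta>\<^sup>2" by (simp add: ba power_mult_distrib)
          have "\<delta> * \<delta> \<le> a * b" using a b \<delta> by (intro mult_mono) auto
          then show "\<delta>\<^sup>2 \<le> a * b" by (simp add: power2_eq_square)
        qed (use \<delta> in auto)
        moreover have "\<bar>ln b - ln a - (b - a) / a\<bar> \<le> (b - a)\<^sup>2 / (a * b)"
          using a b \<delta> by (intro ln_first_order_error) auto
        ultimately have "\<bar>ln b - ln a - (b - a) / a\<bar> \<le> \<eta>\<^sup>2 / \<delta>\<^sup>2" by simp
        moreover have "- ((b - a) / a) = \<eta> * ((x - \<mu>) / a)" by (simp add: ba)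
        ultimately show ?case by (simp add: a_def b_def)
      qed
      moreover have "integrable F (\<lambda>x. ln (1 - (x - \<mu>) * (\<nu> + \<eta>)) - ln (1 - (x - \<mu>) * \<nu>) + \<eta> * ((x - \<mu>) / (1 - (x - \<mu>) * \<nu>)))"
        using \<eta>.integrable_ln_affine integrable_ln_affine integrable_slope
        by (simp del: times_divide_eq_right)
      ultimately show ?thesis
        by (intro order.trans[OF integral_abs_bound] integral_le_const integrable_abs)
    qed
    finally have *: "\<bar>?L (\<nu> + \<eta>) - ?L \<nu> - \<eta> * ?D\<bar> \<le> \<eta>\<^sup>2 / \<delta>\<^sup>2" .
    have "\<bar>(?L (\<nu> + \<eta>) - ?L \<nu>) / \<eta> - ?D\<bar> = \<bar>?L (\<nu> + \<eta>) - ?L \<nu> - \<eta> * ?D\<bar> / \<bar>\<eta>\<bar>"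
    proof -
      have "\<bar>u / \<eta> - D\<bar> = \<bar>u - \<eta> * D\<bar> / \<bar>\<eta>\<bar>" for u D
        using \<eta>(2) by (simp add: diff_divide_distrib flip: abs_divide)
      then show ?thesis .
    qed
    also have "\<dots> \<le> (\<eta>\<^sup>2 / \<delta>\<^sup>2) / \<bar>\<eta>\<bar>" using * by (intro divide_right_mono) auto
    also have "\<dots> = \<bar>\<eta>\<bar> / \<delta>\<^sup>2" using \<eta>(2) by (cases "0 \<le> \<eta>") (simp_all add: power2_eq_square)
    finally show ?thesis .
  qed
  have "((\<lambda>\<eta>. (?L (\<nu> + \<eta>) - ?L \<nu>) / \<eta> - ?D) \<longlongrightarrow> 0) (at 0)"
  proof (rule Lim_null_comparison)
    have "eventually (\<lambda>\<eta>. \<bar>\<eta>\<bar> < \<delta> \<and> \<eta> \<noteq> 0) (at 0)"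
      unfolding eventually_at using \<delta> by (auto intro!: exI[of _ \<delta>])
    then show "\<forall>\<^sub>F \<eta> in at 0. norm ((?L (\<nu> + \<eta>) - ?L \<nu>) / \<eta> - ?D) \<le> \<bar>\<eta>\<bar> / \<delta>\<^sup>2"
      by eventually_elim (use est in auto)
    show "((\<lambda>\<eta>. \<bar>\<eta>\<bar> / \<delta>\<^sup>2) \<longlongrightarrow> 0) (at 0)"
      using tendsto_divide[OF tendsto_rabs[OF tendsto_ident_at] tendsto_const, of "\<delta>\<^sup>2" 0 UNIV] \<delta> by simp
  qed
  then show ?thesis unfolding DERIV_def by (rule LIM_zero_cancel)
qed

lemma dual_objective_0 [simp]: "dual_objective F \<mu> 0 = 0"
  by (simp add: dual_objective_def)

lemma dual_objective_le_lower_rep: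
  assumes d: "d \<ge> 1" and M0: "M 0 = 1" and F\<^sub>0: "is_lower_rep d M F\<^sub>0" and F: "F \<in> moment_class d M"
    and \<mu>: "0 \<le> \<mu>" "\<mu> < 1" and \<nu>: "0 \<le> \<nu>" "(1 - \<mu>) * \<nu> < 1"
  shows "dual_objective F \<mu> \<nu> \<le> dual_objective F\<^sub>0 \<mu> \<nu>"
proof -
  have F0M: "F\<^sub>0 \<in> moment_class d M" using F\<^sub>0 by (rule is_lower_rep_moment_class)
  have "dual_objective F\<^sub>0 \<mu> 0 - dual_objective F \<mu> 0 \<le> dual_objective F\<^sub>0 \<mu> \<nu> - dual_objective F \<mu> \<nu>"
  proof (rule DERIV_nonneg_imp_nondecreasing[OF \<nu>(1)])
    fix s assume s: "0 \<le> s" "s \<le> \<nu>"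
    have "(1 - \<mu>) * s \<le> (1 - \<mu>) * \<nu>" using s \<mu> by (intro mult_left_mono) auto
    then have s1: "(1 - \<mu>) * s < 1" using \<nu> by simp
    have s0: "0 < 1 + \<mu> * s" using s \<mu> by (simp add: add_pos_nonneg)
    interpret F: dual_param F \<mu> s using F \<mu> s0 s1 by unfold_locales (auto simp: moment_class_def)
    interpret F0: dual_param F\<^sub>0 \<mu> s using F0M \<mu> s0 s1 by unfold_locales (auto simp: moment_class_def)
    let ?a = "\<lambda>G. \<integral>x. (x - \<mu>) / (1 - (x - \<mu>) * s) \<partial>G"
    have "?a F\<^sub>0 \<le> ?a F"
    proof (cases "s = 0")
      \<comment> \<open>\<open>A\<close> would involve a division by zero here. The slope is the
        centred first moment, which both distributions share because
        \<open>d \<ge> 1\<close>.\<close>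
      case True
      have "[:- \<mu>, 1:] \<in> polys_below (Suc d)" using d by (intro degree_less_imp_polys_below) simp
      then have "(\<integral>x. poly [:- \<mu>, 1:] x \<partial>F\<^sub>0) = (\<integral>x. poly [:- \<mu>, 1:] x \<partial>F)"
        using expectation_poly_moments[OF F M0] expectation_poly_moments[OF F0M M0] by metis
      then show ?thesis using True by simp
    next
      case False
      then have s: "0 < s" using s by simp
      define A where "A = \<mu> + 1 / s"
      have "1 < A" using s1 s by (simp add: A_def field_simps)
      have eq: "1 / (1 - (x - \<mu>) * s) = (1 / s) * (1 / (A - x))" for x
      proof -
        have "1 - (x - \<mu>) * s = s * (A - x)" using s by (simp add: A_def field_simps)
        then show ?thesis by simp
      qed
      have "(\<integral>x. 1 / (1 - (x - \<mu>) * s) \<partial>F\<^sub>0) \<le> (\<integral>x. 1 / (1 - (x - \<mu>) * s) \<partial>F)"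
        unfolding eq using expectation_resolvent_lower_rep[OF M0 F\<^sub>0 F \<open>1 < A\<close>] s
        by (simp only: integral_mult_right_zero) (simp add: mult_left_mono divide_right_mono)
      then have "s * ?a F\<^sub>0 \<le> s * ?a F" unfolding F.slope_eq F0.slope_eq by simp
      then show ?thesis using s by simp
    qed
    then show "\<exists>y. ((\<lambda>s. dual_objective F\<^sub>0 \<mu> s - dual_objective F \<mu> s) has_real_derivative y) (at s) \<and> 0 \<le> y"
      using DERIV_diff[OF F0.DERIV_dual_objective F.DERIV_dual_objective] by (intro exI conjI) auto
  qed
  then show ?thesis by simp
qed

section \<open>Duality\<close>

lemma ext_expectation_integrable:
  assumes i: "integrable F h"
  shows "ext_expectation F h = ereal (integral\<^sup>L F h)"
proof -
  have fin: "(\<integral>\<^sup>+ x. ennreal (h x) \<partial>F) \<noteq> \<infinity>" "(\<integral>\<^sup>+ x. ennreal (- h x) \<partial>F) \<noteq> \<infinity>"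
    using integrableD(2,3)[OF i] by simp_all
  show ?thesis
    unfolding ext_expectation_def real_lebesgue_integral_def[OF i] using fin
    by (cases "\<integral>\<^sup>+ x. ennreal (h x) \<partial>F"; cases "\<integral>\<^sup>+ x. ennreal (- h x) \<partial>F")
      (simp_all add: enn2ereal_ennreal)
qed

text \<open>An integrable minorant keeps the negative part finite, so \<open>ext_expectation\<close>
  never subtracts infinity from infinity, whether or not \<open>h\<close> is integrable.\<close>

lemma ext_expectation_ge_integral:
  assumes b: "integrable F b" and h: "h \<in> borel_measurable F" and le: "AE x in F. b x \<le> h x"
  shows "ereal (integral\<^sup>L F b) \<le> ext_expectation F h"
proof -
  have "(\<integral>\<^sup>+ x. ennreal (- h x) \<partial>F) \<le> (\<integral>\<^sup>+ x. ennreal (- b x) \<partial>F)"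
    by (rule nn_integral_mono_AE) (use le in eventually_elim, auto intro: ennreal_leI)
  also have "\<dots> < \<infinity>" using integrableD(3)[OF b] by (simp add: less_top)
  finally have neg: "(\<integral>\<^sup>+ x. ennreal (- h x) \<partial>F) < \<infinity>" .
  show ?thesis
  proof (cases "(\<integral>\<^sup>+ x. ennreal (h x) \<partial>F) = \<infinity>")
    case True
    then have "ext_expectation F h = \<infinity>" unfolding ext_expectation_def using neg
      by (cases "\<integral>\<^sup>+ x. ennreal (- h x) \<partial>F") (simp_all add: enn2ereal_ennreal)
    then show ?thesis by simp
  next
    case False
    then have "integrable F h" using h neg by (auto simp: real_integrable_def)
    then show ?thesis using integral_mono_AE[OF b _ le] by (simp add: ext_expectation_integrable)
  qed
qed

text \<open>Let \<open>r\<close> be the density of \<open>F\<close> with respect to \<open>G\<close>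
  and \<open>a\<close> the affine function. Then \<open>ln (a / r) \<le> a / r - 1\<close> bounds
  \<open>ln r\<close> below by \<open>ln a + 1 - a / r\<close>, and the expectation of
  \<open>a / r\<close> under \<open>F\<close> is at most that of \<open>a\<close> under
  \<open>G\<close>, which the mean constraint bounds by 1.\<close>

lemma dual_objective_le_kl_div:
  assumes F: "F \<in> dists01" and G: "G \<in> dists01" and mean: "\<mu> \<le> (\<integral>x. x \<partial>G)"
    and \<mu>: "0 \<le> \<mu>" "\<mu> < 1" and \<nu>: "0 \<le> \<nu>" "(1 - \<mu>) * \<nu> < 1"
  shows "ereal (dual_objective F \<mu> \<nu>) \<le> kl_div F G"
proof (cases "\<exists>g\<in>borel_measurable G. density G g = F")
  case False
  then show ?thesis by (simp add: kl_div_def)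
next
  case True
  interpret F: prob_space F by (rule dists01D[OF F])
  interpret G: prob_space G by (rule dists01D[OF G])
  have [measurable_cong]: "sets F = sets borel" "sets G = sets borel" using dists01D(2)[OF F] dists01D(2)[OF G] .
  have \<nu>': "0 < 1 + \<mu> * \<nu>" using \<mu> \<nu> by (simp add: add_pos_nonneg)
  interpret D: dual_param F \<mu> \<nu> using F \<mu> \<nu> \<nu>' by unfold_locales auto
  from True obtain g where g: "g \<in> borel_measurable G" "density G g = F" by blast
  have ac: "absolutely_continuous G F" using g by (auto simp: absolutely_continuousI_density)
  have seq: "sets F = sets G" using dists01D(2)[OF F] dists01D(2)[OF G] by simp
  define r where "r x = enn2real (RN_deriv G F x)" for x
  have [measurable]: "RN_deriv G F \<in> borel_measurable borel"
    using borel_measurable_RN_deriv[of G F] by measurable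
  have rm [measurable]: "r \<in> borel_measurable borel" unfolding r_def by measurable
  have Fr: "F = density G (\<lambda>x. ennreal (r x))"
  proof -
    have "AE x in G. RN_deriv G F x = ennreal (r x)"
      using G.RN_deriv_finite[OF F.sigma_finite_measure_axioms ac seq]
      by eventually_elim (simp add: r_def less_top)
    then have "density G (RN_deriv G F) = density G (\<lambda>x. ennreal (r x))"
      by (intro density_cong) measurable
    then show ?thesis using G.density_RN_deriv[OF ac seq] by simp
  qed
  have rpos: "AE x in F. 0 < r x"
    by (subst Fr) (simp add: AE_density)
  define a where "a x = 1 - (x - \<mu>) * \<nu>" for x
  have am [measurable]: "a \<in> borel_measurable borel" unfolding a_def by measurable
  have apos': "0 \<le> x \<Longrightarrow> x \<le> 1 \<Longrightarrow> 0 < a x" for x unfolding a_def by (rule D.affine_pos)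
  have apos: "AE x in F. 0 < a x" using dists01D(4)[OF F] by eventually_elim (simp add: apos')
  have aG: "AE x in G. 0 \<le> a x"
    using dists01D(4)[OF G] by eventually_elim (simp add: apos' less_imp_le)
  have intx: "integrable G (\<lambda>x. x)" by (rule dists01_integrable_continuous[OF G]) simp_all
  have ia: "integrable G a" unfolding a_def using intx by simp
  have "(\<integral>x. a x \<partial>G) = 1 - ((\<integral>x. x \<partial>G) - \<mu>) * \<nu>"
    unfolding a_def using intx by (simp add: G.prob_space)
  then have aG1: "(\<integral>x. a x \<partial>G) \<le> 1" using mean \<nu>(1) by simp
  have "(\<integral>\<^sup>+ x. ennreal (a x / r x) \<partial>F) = (\<integral>\<^sup>+ x. ennreal (r x) * ennreal (a x / r x) \<partial>G)"
    by (subst Fr) (simp add: nn_integral_density)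
  \<comment> \<open>Only an inequality, because \<open>G\<close> may charge the set where
    \<open>r\<close> is 0; there \<open>a x / r x\<close> is 0 by convention.\<close>
  also have "\<dots> \<le> (\<integral>\<^sup>+ x. ennreal (a x) \<partial>G)"
  proof (rule nn_integral_mono_AE)
    show "AE x in G. ennreal (r x) * ennreal (a x / r x) \<le> ennreal (a x)"
      using aG
    proof eventually_elim
      case (elim x)
      have "0 \<le> r x" by (simp add: r_def)
      then show ?case using elim by (simp flip: ennreal_mult)
    qed
  qed
  also have "\<dots> = ennreal (\<integral>x. a x \<partial>G)" using ia aG by (rule nn_integral_eq_integral)
  also have "\<dots> \<le> 1" using aG1 by (simp add: ennreal_le_1)
  finally have nn: "(\<integral>\<^sup>+ x. ennreal (a x / r x) \<partial>F) \<le> 1" .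
  have ar0: "AE x in F. 0 \<le> a x / r x" using apos rpos by eventually_elim simp
  have iar: "integrable F (\<lambda>x. a x / r x)"
  proof (rule integrableI_nonneg[OF _ ar0])
    show "(\<integral>\<^sup>+ x. ennreal (a x / r x) \<partial>F) < \<infinity>" using nn by (simp add: order.strict_trans1)
  qed measurable
  have "ennreal (\<integral>x. a x / r x \<partial>F) \<le> 1" using nn nn_integral_eq_integral[OF iar ar0] by simp
  then have ar1: "(\<integral>x. a x / r x \<partial>F) \<le> 1" by (simp add: ennreal_le_1)
  have iln: "integrable F (\<lambda>x. ln (a x))" unfolding a_def by (rule D.integrable_ln_affine)
  have "dual_objective F \<mu> \<nu> \<le> (\<integral>x. ln (a x) + 1 - a x / r x \<partial>F)"
    using iln iar ar1 by (simp add: F.prob_space dual_objective_def a_def)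
  also have "ereal \<dots> \<le> ext_expectation F (\<lambda>x. ln (r x))"
  proof (rule ext_expectation_ge_integral)
    show "integrable F (\<lambda>x. ln (a x) + 1 - a x / r x)" using iln iar by simp
    show "AE x in F. ln (a x) + 1 - a x / r x \<le> ln (r x)"
      using apos rpos
    proof eventually_elim
      case (elim x)
      then show ?case using ln_le_minus_one[of "a x / r x"] by (simp add: ln_div)
    qed
  qed measurable
  also have "\<dots> = kl_div F G" using True by (simp add: kl_div_def r_def)
  finally show ?thesis by simp
qed

section \<open>Tilted distributions and strong duality\<close>

text \<open>\<open>RN_deriv\<close> agrees with a given density only up to \<open>G\<close>-null
  sets. The agreement carries over to \<open>F\<close>, under which \<open>r\<close> is positive
  almost everywhere, so the logarithms agree.\<close>

lemma kl_div_density: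
  assumes F: "F \<in> dists01" and G: "G \<in> dists01" and r: "r \<in> borel_measurable borel"
    and Fr: "density G (\<lambda>x. ennreal (r x)) = F" and int: "integrable F (\<lambda>x. ln (r x))"
  shows "kl_div F G = ereal (\<integral>x. ln (r x) \<partial>F)"
proof -
  interpret G: prob_space G by (rule dists01D[OF G])
  have [measurable_cong]: "sets F = sets borel" "sets G = sets borel" using dists01D(2)[OF F] dists01D(2)[OF G] .
  have r' [measurable]: "(\<lambda>x. ennreal (r x)) \<in> borel_measurable G" using r by measurable
  have "AE x in G. ennreal (r x) = RN_deriv G F x" by (rule G.RN_deriv_unique[OF r' Fr])
  then have "AE x in G. 0 < ennreal (r x) \<longrightarrow> ln (enn2real (RN_deriv G F x)) = ln (r x)"
  proof eventually_elim
    case (elim x)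
    show ?case unfolding elim[symmetric] by simp
  qed
  then have "AE x in density G (\<lambda>x. ennreal (r x)). ln (enn2real (RN_deriv G F x)) = ln (r x)"
    using AE_density[OF r'] by simp
  then have eq: "AE x in F. ln (enn2real (RN_deriv G F x)) = ln (r x)" unfolding Fr .
  have "ext_expectation F (\<lambda>x. ln (enn2real (RN_deriv G F x))) = ext_expectation F (\<lambda>x. ln (r x))"
    unfolding ext_expectation_def using eq
    by (intro arg_cong2[where f="(-)"] arg_cong[where f=enn2ereal] nn_integral_cong_AE) auto
  moreover have "\<exists>g\<in>borel_measurable G. density G g = F" using r' Fr by blast
  ultimately show ?thesis by (simp add: kl_div_def ext_expectation_integrable[OF int])
qed

text \<open>The optimal \<open>G\<close> reweights \<open>F\<close> by \<open>1 / (1 - (x - \<mu>) * \<nu>)\<close> and moves the missing mass to \<open>1\<close>.\<close>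

lemma D_min_le_tilted:
  assumes F: "F \<in> dists01" and \<mu>: "0 \<le> \<mu>" "\<mu> < 1" and \<nu>: "0 < \<nu>"
    and pos: "AE x in F. 0 < 1 - (x - \<mu>) * \<nu>"
    and int: "integrable F (\<lambda>x. 1 / (1 - (x - \<mu>) * \<nu>))"
    and le1: "(\<integral>x. 1 / (1 - (x - \<mu>) * \<nu>) \<partial>F) \<le> 1"
    and cases: "(\<integral>x. 1 / (1 - (x - \<mu>) * \<nu>) \<partial>F) = 1 \<or> (1 - \<mu>) * \<nu> = 1"
  shows "integrable F (\<lambda>x. ln (1 - (x - \<mu>) * \<nu>))" "D_min F \<mu> \<le> ereal (dual_objective F \<mu> \<nu>)"
proof -
  interpret prob_space F by (rule dists01D[OF F])
  note setsF [measurable_cong] = dists01D(2)[OF F]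
  define r where "r x = 1 - (x - \<mu>) * \<nu>" for x
  define c where "c = (\<integral>x. 1 / r x \<partial>F)"
  have rm [measurable]: "r \<in> borel_measurable borel" unfolding r_def by measurable
  have rpos: "AE x in F. 0 < r x" using pos by (simp add: r_def)
  have rint: "integrable F (\<lambda>x. 1 / r x)" using int by (simp add: r_def)
  have rle: "r x \<le> 1 + \<nu>" if "0 \<le> x" for x
  proof -
    have "(\<mu> - x) * \<nu> \<le> 1 * \<nu>" using that \<mu> \<nu> by (intro mult_right_mono) auto
    then show ?thesis by (simp add: r_def algebra_simps)
  qed
  have c1: "c \<le> 1" using le1 by (simp add: c_def r_def)
  \<comment> \<open>\<open>r\<close> is at most \<open>1 + \<nu>\<close> on the interval, which
    keeps \<open>c\<close> away from 0, so that it can serve as a normalising constant.\<close>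
  have "1 / (1 + \<nu>) \<le> c" unfolding c_def
  proof (rule integral_ge_const[OF rint])
    show "AE x in F. 1 / (1 + \<nu>) \<le> 1 / r x"
      using rpos dists01D(4)[OF F] by eventually_elim (use rle \<nu> in \<open>auto intro!: frac_le\<close>)
  qed
  moreover have "0 < 1 / (1 + \<nu>)" using \<nu> by simp
  ultimately have c0: "0 < c" by linarith
  \<comment> \<open>Either no mass is missing, or the density \<open>r\<close> vanishes at 1, where
    the missing mass is put. Both the mean of \<open>G\<close> and the density of \<open>F\<close>
    rest on this alternative.\<close>
  have c_or: "c = 1 \<or> r 1 = 0" using cases by (auto simp: c_def r_def)

  \<comment> \<open>\<open>r\<close> need not be bounded away from 0, so the logarithm is dominated
    by \<open>r - 1\<close> from above and through \<open>1 / r\<close> from below.\<close>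
  show lnint: "integrable F (\<lambda>x. ln (1 - (x - \<mu>) * \<nu>))"
  proof (rule Bochner_Integration.integrable_bound)
    show "integrable F (\<lambda>x. \<nu> + 1 / r x)" using rint by simp
    show "AE x in F. norm (ln (1 - (x - \<mu>) * \<nu>)) \<le> norm (\<nu> + 1 / r x)"
      using rpos dists01D(4)[OF F]
    proof eventually_elim
      case (elim x)
      have "ln (r x) \<le> r x - 1" using elim by (intro ln_le_minus_one) simp
      moreover have "- ln (r x) \<le> 1 / r x - 1" using elim ln_le_minus_one[of "1 / r x"] by (simp add: ln_div)
      moreover have "r x - 1 \<le> \<nu>" using rle[of x] elim by simp
      moreover have "0 < 1 / r x" using elim by simp
      ultimately have "\<bar>ln (r x)\<bar> \<le> \<nu> + 1 / r x" using \<nu> by linarith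
      then show ?case by (simp add: r_def)
    qed
  qed measurable

  \<comment> \<open>The mixture as a two-stage experiment: with probability \<open>c\<close> draw
    from the normalised tilt of \<open>F\<close>, otherwise take 1. The factor \<open>c\<close>
    cancels in \<open>nnG\<close>.\<close>
  define N where "N b = (if b then density F (\<lambda>x. ennreal (1 / (c * r x))) else return borel 1)" for b
  define G where "G = measure_pmf (bernoulli_pmf c) \<bind> N"
  have "prob_space (density F (\<lambda>x. ennreal (1 / (c * r x))))"
  proof (rule prob_spaceI)
    have "emeasure (density F (\<lambda>x. ennreal (1 / (c * r x)))) (space (density F (\<lambda>x. ennreal (1 / (c * r x))))) =
        (\<integral>\<^sup>+ x. ennreal (1 / (c * r x)) \<partial>F)"
      by (subst emeasure_density) (auto intro!: nn_integral_cong)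
    also have "\<dots> = ennreal (\<integral>x. 1 / (c * r x) \<partial>F)"
    proof (rule nn_integral_eq_integral)
      show "integrable F (\<lambda>x. 1 / (c * r x))"
        using integrable_mult_right[OF rint, of "1 / c"] by simp
      show "AE x in F. 0 \<le> 1 / (c * r x)" using rpos by eventually_elim (use c0 in simp)
    qed
    also have "(\<integral>x. 1 / (c * r x) \<partial>F) = 1 / c * (\<integral>x. 1 / r x \<partial>F)"
      by (subst integral_mult_right_zero[symmetric]) simp
    also have "\<dots> = 1" using c0 unfolding c_def[symmetric] by simp
    finally show "emeasure (density F (\<lambda>x. ennreal (1 / (c * r x)))) (space (density F (\<lambda>x. ennreal (1 / (c * r x))))) = 1"
      by simp
  qed
  then have Nb: "prob_space (N b)" "sets (N b) = sets borel" for b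
    by (auto simp: N_def setsF prob_space_return)
  have N: "N \<in> measure_pmf (bernoulli_pmf c) \<rightarrow>\<^sub>M subprob_algebra borel"
    using Nb by (auto simp: space_subprob_algebra prob_space_imp_subprob_space)
  have setsG [measurable_cong]: "sets G = sets borel" unfolding G_def
    by (rule sets_bind) (simp_all add: Nb)
  have nnG: "(\<integral>\<^sup>+ x. \<phi> x \<partial>G) = (\<integral>\<^sup>+ x. \<phi> x * ennreal (1 / r x) \<partial>F) + \<phi> 1 * ennreal (1 - c)"
    if \<phi> [measurable]: "\<phi> \<in> borel_measurable borel" for \<phi> :: "real \<Rightarrow> ennreal"
  proof -
    have "(\<integral>\<^sup>+ x. \<phi> x \<partial>G) = (\<integral>\<^sup>+ x. \<phi> x \<partial>N True) * ennreal c + (\<integral>\<^sup>+ x. \<phi> x \<partial>N False) * ennreal (1 - c)"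
      unfolding G_def using c0 c1 by (subst nn_integral_bind[OF \<phi> N]) simp
    also have "(\<integral>\<^sup>+ x. \<phi> x \<partial>N False) = \<phi> 1" by (simp add: N_def nn_integral_return)
    also have "(\<integral>\<^sup>+ x. \<phi> x \<partial>N True) * ennreal c = (\<integral>\<^sup>+ x. ennreal (1 / (c * r x)) * \<phi> x * ennreal c \<partial>F)"
      by (simp add: N_def nn_integral_density nn_integral_multc)
    also have "\<dots> = (\<integral>\<^sup>+ x. \<phi> x * ennreal (1 / r x) \<partial>F)"
    proof (intro nn_integral_cong_AE)
      show "AE x in F. ennreal (1 / (c * r x)) * \<phi> x * ennreal c = \<phi> x * ennreal (1 / r x)"
        using rpos
      proof eventually_elim
        case (elim x)
        then have "ennreal (1 / r x) = ennreal (1 / (c * r x)) * ennreal c"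
          using c0 by (simp flip: ennreal_mult)
        then show ?case by (simp add: ac_simps)
      qed
    qed
    finally show ?thesis .
  qed
  have nnr: "(\<integral>\<^sup>+ x. ennreal (1 / r x) \<partial>F) = ennreal c"
    unfolding c_def by (rule nn_integral_eq_integral[OF rint]) (use rpos in eventually_elim, simp)
  have G1: "emeasure G A = 1" if A [measurable]: "A \<in> sets borel" and "{0..1} \<subseteq> A" for A
  proof -
    have "emeasure G A = (\<integral>\<^sup>+ x. indicator A x \<partial>G)" using setsG A by simp
    also have "\<dots> = (\<integral>\<^sup>+ x. indicator A x * ennreal (1 / r x) \<partial>F) + ennreal (1 - c)"
    proof -
      have "1 \<in> A" using \<open>{0..1} \<subseteq> A\<close> by auto
      then show ?thesis by (subst nnG) simp_all
    qed
    also have "(\<integral>\<^sup>+ x. indicator A x * ennreal (1 / r x) \<partial>F) = (\<integral>\<^sup>+ x. ennreal (1 / r x) \<partial>F)"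
    proof (rule nn_integral_cong_AE)
      show "AE x in F. indicator A x * ennreal (1 / r x) = ennreal (1 / r x)"
        using dists01D(4)[OF F] by eventually_elim (use \<open>{0..1} \<subseteq> A\<close> in \<open>auto simp: indicator_def\<close>)
    qed
    finally show ?thesis using c0 c1 by (simp add: nnr flip: ennreal_plus)
  qed
  have G: "G \<in> dists01"
    using G1[of UNIV] G1[of "{0..1}"] setsG sets_eq_imp_space_eq[OF setsG]
    by (auto simp: dists01_def intro!: prob_spaceI)
  have mean: "(\<integral>x. x \<partial>G) = \<mu>"
  proof -
    have xr: "integrable F (\<lambda>x. \<mu> * (1 / r x) + (1 / r x - 1) / \<nu>)"
      using rint by (simp del: times_divide_eq_right)
    \<comment> \<open>Substituting \<open>x = \<mu> + (1 - r x) / \<nu>\<close> makes the mean a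
      function of \<open>c\<close> alone, \<open>\<mu> * c + (c - 1) / \<nu> + (1 - c)\<close>. This
      is \<open>\<mu>\<close> if \<open>c = 1\<close> or
      \<open>1 / \<nu> = 1 - \<mu>\<close>.\<close>
    have eq: "AE x in F. \<mu> * (1 / r x) + (1 / r x - 1) / \<nu> = x * (1 / r x)"
      using rpos
    proof eventually_elim
      case (elim x)
      have "x - \<mu> = (1 - r x) / \<nu>" using \<nu> by (simp add: r_def)
      then have "x = \<mu> + (1 - r x) / \<nu>" by simp
      then have "x * (1 / r x) = \<mu> * (1 / r x) + (1 - r x) / \<nu> * (1 / r x)"
        by (metis distrib_right)
      also have "(1 - r x) / \<nu> * (1 / r x) = (1 / r x - 1) / \<nu>" using elim \<nu> by (simp add: field_simps)
      finally show ?case by simp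
    qed
    have nonneg: "AE x in F. 0 \<le> \<mu> * (1 / r x) + (1 / r x - 1) / \<nu>"
      using eq rpos dists01D(4)[OF F]
    proof eventually_elim
      case (elim x)
      then show ?case unfolding elim(1) by simp
    qed
    have "(\<integral>\<^sup>+ x. ennreal x \<partial>G) = (\<integral>\<^sup>+ x. ennreal x * ennreal (1 / r x) \<partial>F) + ennreal (1 - c)"
      by (subst nnG) auto
    also have "(\<integral>\<^sup>+ x. ennreal x * ennreal (1 / r x) \<partial>F) = (\<integral>\<^sup>+ x. ennreal (\<mu> * (1 / r x) + (1 / r x - 1) / \<nu>) \<partial>F)"
    proof (rule nn_integral_cong_AE)
      show "AE x in F. ennreal x * ennreal (1 / r x) = ennreal (\<mu> * (1 / r x) + (1 / r x - 1) / \<nu>)"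
        using eq rpos dists01D(4)[OF F]
      proof eventually_elim
        case (elim x)
        then show ?case unfolding elim(1) by (simp flip: ennreal_mult)
      qed
    qed
    also have "\<dots> = ennreal (\<integral>x. \<mu> * (1 / r x) + (1 / r x - 1) / \<nu> \<partial>F)"
      using nonneg by (rule nn_integral_eq_integral[OF xr])
    also have "(\<integral>x. \<mu> * (1 / r x) + (1 / r x - 1) / \<nu> \<partial>F) = \<mu> * c + (c - 1) / \<nu>"
      unfolding c_def using rint by (simp add: prob_space del: times_divide_eq_right)
    finally have nn: "(\<integral>\<^sup>+ x. ennreal x \<partial>G) = ennreal (\<mu> * c + (c - 1) / \<nu>) + ennreal (1 - c)" .
    have "0 \<le> (\<integral>x. \<mu> * (1 / r x) + (1 / r x - 1) / \<nu> \<partial>F)"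
      using nonneg by (rule integral_nonneg_AE)
    then have "0 \<le> \<mu> * c + (c - 1) / \<nu>"
      unfolding c_def using rint by (simp add: prob_space del: times_divide_eq_right)
    then have "(\<integral>\<^sup>+ x. ennreal x \<partial>G) = ennreal (\<mu> * c + (c - 1) / \<nu> + (1 - c))"
      using nn c1 by simp
    also have "\<mu> * c + (c - 1) / \<nu> + (1 - c) = \<mu>"
    proof -
      have "(c - 1) / \<nu> = (c - 1) * (1 - \<mu>)" if "r 1 = 0"
      proof -
        have "1 / \<nu> = 1 - \<mu>" using that \<nu> by (simp add: r_def field_simps)
        then show ?thesis by (metis times_divide_eq_right mult.right_neutral)
      qed
      then show ?thesis using c_or by (auto simp: algebra_simps)
    qed
    finally have "(\<integral>\<^sup>+ x. ennreal x \<partial>G) = ennreal \<mu>" .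
    moreover have "AE x in G. 0 \<le> x" using dists01D(4)[OF G] by eventually_elim simp
    moreover have "(\<lambda>x. x) \<in> borel_measurable G" by measurable
    ultimately show ?thesis using \<mu> by (simp add: integral_eq_nn_integral)
  qed
  have Fr: "density G (\<lambda>x. ennreal (r x)) = F"
  proof (rule measure_eqI)
    fix A assume "A \<in> sets (density G (\<lambda>x. ennreal (r x)))"
    then have A [measurable]: "A \<in> sets borel" by (simp add: setsG)
    have "emeasure (density G (\<lambda>x. ennreal (r x))) A = (\<integral>\<^sup>+ x. ennreal (r x) * indicator A x \<partial>G)"
      using A by (intro emeasure_density) (auto simp: setsG)
    \<comment> \<open>The atom at 1 carries the factor \<open>r 1 * (1 - c)\<close>, which is 0 by
      \<open>c_or\<close>.\<close>
    also have "\<dots> = (\<integral>\<^sup>+ x. ennreal (r x) * indicator A x * ennreal (1 / r x) \<partial>F)"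
      using c_or by (subst nnG) auto
    also have "\<dots> = (\<integral>\<^sup>+ x. indicator A x \<partial>F)"
    proof (intro nn_integral_cong_AE)
      show "AE x in F. ennreal (r x) * indicator A x * ennreal (1 / r x) = indicator A x"
        using rpos
      proof eventually_elim
        case (elim x)
        then have "ennreal (r x) * ennreal (1 / r x) = 1" by (simp flip: ennreal_mult)
        then show ?case by (simp add: indicator_def)
      qed
    qed
    also have "\<dots> = emeasure F A" using A by (simp add: setsF)
    finally show "emeasure (density G (\<lambda>x. ennreal (r x))) A = emeasure F A" .
  qed (simp add: setsF setsG)
  have "kl_div F G = ereal (dual_objective F \<mu> \<nu>)"
    using kl_div_density[OF F G rm Fr] lnint by (simp add: dual_objective_def r_def)
  moreover have "D_min F \<mu> \<le> kl_div F G" unfolding D_min_def using G mean by (intro INF_lower) simp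
  ultimately show "D_min F \<mu> \<le> ereal (dual_objective F \<mu> \<nu>)" by simp
qed

text \<open>\<open>F\<close> competes against itself, with constant density 1.\<close>

lemma D_min_le_if_mean_ge:
  assumes F: "F \<in> dists01" and mean: "\<mu> \<le> (\<integral>x. x \<partial>F)"
  shows "D_min F \<mu> \<le> 0"
proof -
  have "density F (\<lambda>x. ennreal 1) = F"
    by (rule measure_eqI) (simp_all add: emeasure_density)
  then have "kl_div F F = 0" using kl_div_density[OF F F, of "\<lambda>_. 1"] by simp
  moreover have "D_min F \<mu> \<le> kl_div F F" unfolding D_min_def using assms by (intro INF_lower) simp
  ultimately show ?thesis by simp
qed

text \<open>Fatou's lemma along parameters increasing to the boundary value. An atom of
  \<open>F\<close> at 1 would make the limiting integral infinite, so there is none.\<close>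

lemma tilted_limit:
  assumes F: "F \<in> dists01" and \<mu>: "0 \<le> \<mu>" "\<mu> < 1"
    and le: "\<And>\<nu>. 0 \<le> \<nu> \<Longrightarrow> (1 - \<mu>) * \<nu> < 1 \<Longrightarrow> (\<integral>x. 1 / (1 - (x - \<mu>) * \<nu>) \<partial>F) \<le> 1"
  defines "\<nu>\<^sub>1 \<equiv> 1 / (1 - \<mu>)"
  shows "AE x in F. 0 < 1 - (x - \<mu>) * \<nu>\<^sub>1" "integrable F (\<lambda>x. 1 / (1 - (x - \<mu>) * \<nu>\<^sub>1))"
    "(\<integral>x. 1 / (1 - (x - \<mu>) * \<nu>\<^sub>1) \<partial>F) \<le> 1"
proof -
  note setsF [measurable_cong] = dists01D(2)[OF F]
  \<comment> \<open>Chosen so that \<open>(1 - \<mu>) * \<nu> n = 1 - 1 / (n + 1)\<close>; at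
    \<open>x = 1\<close> the integrand is then exactly \<open>n + 1\<close>.\<close>
  define \<nu> where "\<nu> n = (1 - 1 / real (Suc n)) * \<nu>\<^sub>1" for n
  have m\<nu>: "(1 - \<mu>) * \<nu> n = 1 - 1 / real (Suc n)" for n using \<mu> by (simp add: \<nu>_def \<nu>\<^sub>1_def)
  have \<nu>0: "0 \<le> \<nu> n" for n using \<mu> by (simp add: \<nu>_def \<nu>\<^sub>1_def)
  have \<nu>1: "(1 - \<mu>) * \<nu> n < 1" for n unfolding m\<nu> by simp
  have D: "dual_param F \<mu> (\<nu> n)" for n
    using F \<mu> \<nu>1[of n] \<nu>0[of n] by unfold_locales (simp_all add: add_pos_nonneg)
  define u where "u n x = ennreal (1 / (1 - (x - \<mu>) * \<nu> n))" for n x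
  \<comment> \<open>The value at 1 is set to infinity explicitly, since \<open>1 / 0 = 0\<close>
    would hide an atom there.\<close>
  define v where "v x = (if x = 1 then \<infinity> else ennreal (1 / (1 - (x - \<mu>) * \<nu>\<^sub>1)))" for x
  have um [measurable]: "u n \<in> borel_measurable borel" for n unfolding u_def by measurable
  have vm [measurable]: "v \<in> borel_measurable borel" unfolding v_def by measurable
  have r1: "1 - (x - \<mu>) * \<nu>\<^sub>1 = (1 - x) * \<nu>\<^sub>1" for x using \<mu> by (simp add: \<nu>\<^sub>1_def field_simps)
  have lim: "(\<lambda>n. u n x) \<longlonglongrightarrow> v x" for x
  proof (cases "x = 1")
    case True
    have "u n x = of_nat (Suc n)" for n
      unfolding u_def True m\<nu> by (simp del: of_nat_Suc add: ennreal_of_nat_eq_real_of_nat)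
    moreover have "(\<lambda>n. of_nat (Suc n) :: ennreal) \<longlonglongrightarrow> \<infinity>"
      using LIMSEQ_Suc[OF of_nat_tendsto_top_ennreal] by simp
    ultimately show ?thesis using True by (simp add: v_def)
  next
    case False
    have "(\<lambda>n. (1 - 1 / real (Suc n)) * \<nu>\<^sub>1) \<longlonglongrightarrow> (1 - 0) * \<nu>\<^sub>1"
      by (intro tendsto_intros LIMSEQ_Suc[OF lim_1_over_n])
    then have "\<nu> \<longlonglongrightarrow> \<nu>\<^sub>1" by (simp add: \<nu>_def[abs_def])
    moreover have "1 - (x - \<mu>) * \<nu>\<^sub>1 \<noteq> 0" using False \<mu> by (simp only: r1) (simp add: \<nu>\<^sub>1_def)
    ultimately have "(\<lambda>n. ennreal (1 / (1 - (x - \<mu>) * \<nu> n))) \<longlonglongrightarrow> ennreal (1 / (1 - (x - \<mu>) * \<nu>\<^sub>1))"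
      by (intro tendsto_ennrealI tendsto_intros)
    then show ?thesis using False by (simp add: u_def v_def)
  qed
  have ule: "(\<integral>\<^sup>+ x. u n x \<partial>F) \<le> 1" for n
  proof -
    interpret dual_param F \<mu> "\<nu> n" by (rule D)
    have "(\<integral>\<^sup>+ x. u n x \<partial>F) = ennreal (\<integral>x. 1 / (1 - (x - \<mu>) * \<nu> n) \<partial>F)"
      unfolding u_def
    proof (rule nn_integral_eq_integral[OF integrable_inverse])
      show "AE x in F. 0 \<le> 1 / (1 - (x - \<mu>) * \<nu> n)"
        using dists01D(4)[OF F]
      proof eventually_elim
        case (elim x)
        then have "0 < 1 - (x - \<mu>) * \<nu> n" by (intro affine_pos) auto
        then show ?case by (intro divide_nonneg_pos) auto
      qed
    qed
    then show ?thesis using le[OF \<nu>0 \<nu>1, of n] by (simp add: ennreal_le_1)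
  qed
  have "(\<integral>\<^sup>+ x. v x \<partial>F) = (\<integral>\<^sup>+ x. liminf (\<lambda>n. u n x) \<partial>F)"
    by (intro nn_integral_cong) (simp add: lim_imp_Liminf[OF _ lim])
  also have "\<dots> \<le> liminf (\<lambda>n. \<integral>\<^sup>+ x. u n x \<partial>F)" by (intro nn_integral_liminf) measurable
  also have "\<dots> \<le> liminf (\<lambda>n. 1)" by (intro Liminf_mono always_eventually allI ule)
  finally have v1: "(\<integral>\<^sup>+ x. v x \<partial>F) \<le> 1" by (simp add: Liminf_const)
  then have "AE x in F. v x \<noteq> \<infinity>" by (intro nn_integral_PInf_AE) (auto simp: top_unique)
  then have neq1: "AE x in F. x \<noteq> 1" by eventually_elim (auto simp: v_def)
  show pos: "AE x in F. 0 < 1 - (x - \<mu>) * \<nu>\<^sub>1"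
    using neq1 dists01D(4)[OF F]
  proof eventually_elim
    case (elim x)
    then show ?case using \<mu> unfolding r1 by (simp add: \<nu>\<^sub>1_def)
  qed
  then have nonneg: "AE x in F. 0 \<le> 1 / (1 - (x - \<mu>) * \<nu>\<^sub>1)"
  proof eventually_elim
    case (elim x)
    then show ?case by (intro divide_nonneg_pos) auto
  qed
  have "(\<integral>\<^sup>+ x. ennreal (1 / (1 - (x - \<mu>) * \<nu>\<^sub>1)) \<partial>F) = (\<integral>\<^sup>+ x. v x \<partial>F)"
  proof (rule nn_integral_cong_AE)
    show "AE x in F. ennreal (1 / (1 - (x - \<mu>) * \<nu>\<^sub>1)) = v x"
      using neq1 by eventually_elim (simp add: v_def)
  qed
  with v1 have nn: "(\<integral>\<^sup>+ x. ennreal (1 / (1 - (x - \<mu>) * \<nu>\<^sub>1)) \<partial>F) \<le> 1" by simp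
  show int: "integrable F (\<lambda>x. 1 / (1 - (x - \<mu>) * \<nu>\<^sub>1))"
  proof (rule integrableI_nonneg[OF _ nonneg])
    show "(\<integral>\<^sup>+ x. ennreal (1 / (1 - (x - \<mu>) * \<nu>\<^sub>1)) \<partial>F) < \<infinity>" using nn by (simp add: order.strict_trans1)
  qed measurable
  show "(\<integral>x. 1 / (1 - (x - \<mu>) * \<nu>\<^sub>1) \<partial>F) \<le> 1"
    using nn nn_integral_eq_integral[OF int nonneg] by (simp add: ennreal_le_1)
qed

text \<open>Strong duality, for an arbitrary upper bound \<open>C\<close> of the dual values. Either
  the mean of \<open>F\<close> is already large enough, or the mass of the tilt never exceeds 1 and
  the boundary parameter is used, or it exceeds 1 somewhere and an interior maximiser of the dual
  objective gives a tilt of mass 1.\<close>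

lemma D_min_le_if_dual_objective_le:
  assumes F: "F \<in> dists01" and \<mu>: "0 \<le> \<mu>" "\<mu> < 1"
    and bound: "\<And>\<nu>. 0 \<le> \<nu> \<Longrightarrow> (1 - \<mu>) * \<nu> < 1 \<Longrightarrow> ereal (dual_objective F \<mu> \<nu>) \<le> C"
  shows "D_min F \<mu> \<le> C"
proof -
  interpret prob_space F by (rule dists01D[OF F])
  note setsF [measurable_cong] = dists01D(2)[OF F]
  have C0: "0 \<le> C" using bound[of 0] by (simp add: zero_ereal_def)
  have D: "dual_param F \<mu> \<nu>" if "0 \<le> \<nu>" "(1 - \<mu>) * \<nu> < 1" for \<nu>
    using F \<mu> that by unfold_locales (simp_all add: add_pos_nonneg)
  let ?w = "\<lambda>\<nu>. \<integral>x. 1 / (1 - (x - \<mu>) * \<nu>) \<partial>F"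
  consider (mean) "\<mu> \<le> (\<integral>x. x \<partial>F)"
    | (boundary) "\<And>\<nu>. 0 \<le> \<nu> \<Longrightarrow> (1 - \<mu>) * \<nu> < 1 \<Longrightarrow> ?w \<nu> \<le> 1"
    | (interior) \<nu> where "(\<integral>x. x \<partial>F) < \<mu>" "0 \<le> \<nu>" "(1 - \<mu>) * \<nu> < 1" "1 < ?w \<nu>"
    by (meson not_le)
  then show ?thesis
  proof cases
    case mean
    then show ?thesis using D_min_le_if_mean_ge[OF F] C0 by (blast intro: order.trans)
  next
    case boundary
    define \<nu>\<^sub>1 where "\<nu>\<^sub>1 = 1 / (1 - \<mu>)"
    have lim: "AE x in F. 0 < 1 - (x - \<mu>) * \<nu>\<^sub>1" "integrable F (\<lambda>x. 1 / (1 - (x - \<mu>) * \<nu>\<^sub>1))"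
        "?w \<nu>\<^sub>1 \<le> 1"
      unfolding \<nu>\<^sub>1_def using boundary by (rule tilted_limit[OF F \<mu>]; simp)+
    have \<nu>1: "0 < \<nu>\<^sub>1" "(1 - \<mu>) * \<nu>\<^sub>1 = 1" using \<mu> by (simp_all add: \<nu>\<^sub>1_def)
    note tilt = D_min_le_tilted[OF F \<mu> \<nu>1(1) lim disjI2[OF \<nu>1(2)]]
    \<comment> \<open>The bound is assumed only below \<open>\<nu>\<^sub>1\<close>. Concavity of the
      logarithm between 1 and \<open>1 - (x - \<mu>) * \<nu>\<^sub>1\<close> moves the parameter to
      \<open>t * \<nu>\<^sub>1\<close> at the cost of a factor \<open>t\<close>, which then tends to
      1.\<close>
    have step: "ereal (t * dual_objective F \<mu> \<nu>\<^sub>1) \<le> C" if t: "0 < t" "t < 1" for t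
    proof -
      have "0 \<le> t * \<nu>\<^sub>1" using t \<nu>1 by simp
      have "(1 - \<mu>) * (t * \<nu>\<^sub>1) = t" using \<nu>1(2) by (metis mult.left_commute mult.right_neutral)
      then have t1: "(1 - \<mu>) * (t * \<nu>\<^sub>1) < 1" using t by linarith
      interpret dual_param F \<mu> "t * \<nu>\<^sub>1" using \<open>0 \<le> t * \<nu>\<^sub>1\<close> t1 by (rule D)
      have "t * dual_objective F \<mu> \<nu>\<^sub>1 = (\<integral>x. t * ln (1 - (x - \<mu>) * \<nu>\<^sub>1) \<partial>F)"
        by (simp add: dual_objective_def)
      also have "\<dots> \<le> dual_objective F \<mu> (t * \<nu>\<^sub>1)"
        unfolding dual_objective_def
      proof (rule integral_mono_AE)
        show "integrable F (\<lambda>x. t * ln (1 - (x - \<mu>) * \<nu>\<^sub>1))" using tilt(1) by simp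
        show "integrable F (\<lambda>x. ln (1 - (x - \<mu>) * (t * \<nu>\<^sub>1)))" by (rule integrable_ln_affine)
        show "AE x in F. t * ln (1 - (x - \<mu>) * \<nu>\<^sub>1) \<le> ln (1 - (x - \<mu>) * (t * \<nu>\<^sub>1))"
          using lim(1)
        proof eventually_elim
          case (elim x)
          have "(1 - t) * ln 1 + t * ln (1 - (x - \<mu>) * \<nu>\<^sub>1) \<le> ln ((1 - t) * 1 + t * (1 - (x - \<mu>) * \<nu>\<^sub>1))"
            using concave_onD[OF ln_concave, of t 1 "1 - (x - \<mu>) * \<nu>\<^sub>1"] elim t by simp
          then show ?case by (simp add: algebra_simps)
        qed
      qed
      also have "ereal \<dots> \<le> C" using \<open>0 \<le> t * \<nu>\<^sub>1\<close> t1 by (rule bound)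
      finally show ?thesis by simp
    qed
    have "ereal (dual_objective F \<mu> \<nu>\<^sub>1) \<le> C"
    proof (cases C)
      case (real c)
      then show ?thesis using step by (auto intro: field_le_mult_one_interval)
    qed (use C0 in auto)
    then show ?thesis using tilt(2) by (rule order.trans[rotated])
  next
    case (interior \<nu>)
    let ?L = "dual_objective F \<mu>"
    let ?D = "\<lambda>s. - (\<integral>x. (x - \<mu>) / (1 - (x - \<mu>) * s) \<partial>F)"
    have \<nu>pos: "0 < \<nu>" using interior by (cases "\<nu> = 0") (auto simp: prob_space)
    have le\<nu>: "(1 - \<mu>) * s < 1" if "s \<le> \<nu>" for s
      using mult_left_mono[OF that, of "1 - \<mu>"] interior(3) \<mu> by linarith
    have der: "(?L has_real_derivative ?D s) (at s)" if "0 \<le> s" "s \<le> \<nu>" for s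
      using D[OF that(1) le\<nu>[OF that(2)]] by (rule dual_param.DERIV_dual_objective)
    \<comment> \<open>A maximum over \<open>{0..\<nu>}\<close> exists by compactness. The slope is
      positive at 0 and negative at \<open>\<nu>\<close>, so the maximiser is interior and
      critical.\<close>
    have cont: "continuous_on {0..\<nu>} ?L"
      by (intro continuous_at_imp_continuous_on ballI DERIV_isCont[OF der]) auto
    obtain s where s: "s \<in> {0..\<nu>}" "\<And>y. y \<in> {0..\<nu>} \<Longrightarrow> ?L y \<le> ?L s"
      using continuous_attains_sup[OF compact_Icc _ cont] \<nu>pos by auto
    have "?D 0 > 0"
    proof -
      have "integrable F (\<lambda>x. x)" by (rule dists01_integrable_continuous[OF F]) simp_all
      then show ?thesis using interior(1) by (simp add: prob_space)
    qed
    then obtain e where e: "e > 0" "\<And>h. 0 < h \<Longrightarrow> h < e \<Longrightarrow> ?L 0 < ?L (0 + h)"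
      using DERIV_pos_inc_right[OF der[of 0]] \<nu>pos by auto
    have s0: "s \<noteq> 0"
    proof
      assume "s = 0"
      then show False using e(2)[of "min (e / 2) \<nu>"] s(2)[of "min (e / 2) \<nu>"] e(1) \<nu>pos
        by (auto simp: min_less_iff_disj)
    qed
    have "\<nu> * ?D \<nu> < 0"
      using dual_param.slope_eq[OF D[OF interior(2,3)]] interior(4) by simp
    then have "?D \<nu> < 0" using \<nu>pos by (simp add: zero_less_mult_iff)
    then obtain e' where e': "e' > 0" "\<And>h. 0 < h \<Longrightarrow> h < e' \<Longrightarrow> ?L \<nu> < ?L (\<nu> - h)"
      using DERIV_neg_dec_left[OF der[of \<nu>]] \<nu>pos by auto
    have s1: "s \<noteq> \<nu>"
    proof
      assume "s = \<nu>"
      then show False using e'(2)[of "min (e' / 2) \<nu>"] s(2)[of "\<nu> - min (e' / 2) \<nu>"] e'(1) \<nu>pos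
        by (auto simp: min_less_iff_disj)
    qed
    have s01: "0 < s" "s < \<nu>" using s(1) s0 s1 by auto
    have "?D s = 0"
    proof (rule DERIV_local_max[OF der])
      show "0 < min s (\<nu> - s)" using s01 by simp
      show "\<forall>y. \<bar>s - y\<bar> < min s (\<nu> - s) \<longrightarrow> ?L y \<le> ?L s"
        by (intro allI impI s(2)) (auto simp: abs_less_iff)
    qed (use s01 in auto)
    have sp: "0 \<le> s" "(1 - \<mu>) * s < 1" using s01 le\<nu>[of s] by auto
    interpret dual_param F \<mu> s using sp by (rule D)
    \<comment> \<open>By \<open>slope_eq\<close> a vanishing slope means that the tilt has mass 1,
      so no mass has to be moved.\<close>
    have w: "?w s = 1" using slope_eq \<open>?D s = 0\<close> by simp
    have "AE x in F. 0 < 1 - (x - \<mu>) * s"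
      using dists01D(4)[OF F]
    proof eventually_elim
      case (elim x)
      then show ?case by (intro affine_pos) auto
    qed
    then have "D_min F \<mu> \<le> ereal (?L s)"
      using w by (intro D_min_le_tilted(2)[OF F \<mu> s01(1) _ integrable_inverse]) auto
    also have "\<dots> \<le> C" using sp by (rule bound)
    finally show ?thesis .
  qed
qed

section \<open>Optimality of the lower principal representation\<close>

text \<open>Strong duality for \<open>F\<close>, with \<open>C = D_min F\<^sub>0 \<mu>\<close>, and
  weak duality for \<open>F\<^sub>0\<close> enclose the comparison of the dual objectives.\<close>

lemma D_min_le_lower_rep:
  assumes "d \<ge> 1" "M 0 = 1" "is_lower_rep d M F\<^sub>0" "F \<in> moment_class d M" "0 \<le> \<mu>" "\<mu> < 1"
  shows "D_min F \<mu> \<le> D_min F\<^sub>0 \<mu>"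
proof (rule D_min_le_if_dual_objective_le)
  show F: "F \<in> dists01" using assms by (simp add: moment_class_def)
  have F0: "F\<^sub>0 \<in> dists01" using is_lower_rep_moment_class[OF assms(3)] by (simp add: moment_class_def)
  fix \<nu> :: real assume \<nu>: "0 \<le> \<nu>" "(1 - \<mu>) * \<nu> < 1"
  have "ereal (dual_objective F \<mu> \<nu>) \<le> ereal (dual_objective F\<^sub>0 \<mu> \<nu>)"
    using dual_objective_le_lower_rep[OF assms \<nu>] by simp
  also have "\<dots> \<le> D_min F\<^sub>0 \<mu>"
    unfolding D_min_def using dual_objective_le_kl_div[OF F0 _ _ assms(5,6) \<nu>] by (intro INF_greatest) auto
  finally show "ereal (dual_objective F \<mu> \<nu>) \<le> D_min F\<^sub>0 \<mu>" .
qed (use assms in auto)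

theorem lemma2:
  fixes d :: nat and M :: "nat \<Rightarrow> real" and \<mu> :: real
  assumes "d \<ge> 1"
    and "M 0 = 1"
    and "moment_class d M \<noteq> {}"
    and "0 \<le> \<mu>" and "\<mu> < 1"
  shows "(\<exists>!F\<^sub>0. is_lower_rep d M F\<^sub>0) \<and>
    (\<forall>F\<^sub>0. is_lower_rep d M F\<^sub>0 \<longrightarrow>
       F\<^sub>0 \<in> moment_class d M \<and>
       (SUP F\<in>moment_class d M. D_min F \<mu> - D_min_moments d M \<mu>)
         = (SUP F\<in>moment_class d M. D_min F \<mu>) - D_min_moments d M \<mu> \<and>
       D_min F\<^sub>0 \<mu> - D_min_moments d M \<mu>
         = (SUP F\<in>moment_class d M. D_min F \<mu> - D_min_moments d M \<mu>))"
proof (intro conjI allI impI)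
  show "\<exists>!F\<^sub>0. is_lower_rep d M F\<^sub>0"
    using ex_lower_rep[of M, OF assms(2)] is_lower_rep_unique[of M, OF assms(2)] assms(3) by blast
  fix F\<^sub>0 assume F0: "is_lower_rep d M F\<^sub>0"
  show mem: "F\<^sub>0 \<in> moment_class d M" using F0 by (rule is_lower_rep_moment_class)
  have max: "D_min F \<mu> \<le> D_min F\<^sub>0 \<mu>" if "F \<in> moment_class d M" for F
    using D_min_le_lower_rep[of d M, OF assms(1,2) F0 that assms(4,5)] .
  have sup: "(SUP F\<in>moment_class d M. D_min F \<mu>) = D_min F\<^sub>0 \<mu>"
    using max by (intro SUP_eqI) (auto intro: mem)
  \<comment> \<open>Subtraction in \<open>ereal\<close> is monotone in its first argument also at
    infinite values, so the maximiser of \<open>D_min\<close> maximises the difference.\<close>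
  show eq: "D_min F\<^sub>0 \<mu> - D_min_moments d M \<mu> = (SUP F\<in>moment_class d M. D_min F \<mu> - D_min_moments d M \<mu>)"
    using max by (intro SUP_eqI[symmetric]) (auto intro: mem ereal_minus_mono)
  show "(SUP F\<in>moment_class d M. D_min F \<mu> - D_min_moments d M \<mu>)
      = (SUP F\<in>moment_class d M. D_min F \<mu>) - D_min_moments d M \<mu>"
    unfolding sup eq ..
qed

end
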